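(* Let $1\leq \ell<k/2$ be integers and let $d$ be the (common) degree of the vertices of $H_{\ell,k}$. Then there are $\varepsilon=\varepsilon(\ell,k)>0$ and a constant $C>0$ such that $\mathrm{ex}(n,H_{\ell,k})\leq C n^{2-1/d-\varepsilon}$ for all positive integers $n$.
   Context: For integers $1\leq \ell<k/2$, $H_{\ell,k}$ is the bipartite graph whose two parts are $[k]^{(\ell)}$ (the $\ell$-element subsets of $[k]=\{1,\dots,k\}$) and $[k]^{(k-\ell)}$ (the $(k-\ell)$-element subsets of $[k]$), in which $S\in[k]^{(\ell)}$ and $T\in[k]^{(k-\ell)}$ are adjacent if and only if $S\subset T$. This graph is regular. For a graph $H$, $\mathrm{ex}(n,H)$ is the maximum number of edges in an $n$-vertex graph containing no subgraph isomorphic to $H$. *)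

theory Defs
  imports Complex_Main "HOL-Library.Ramsey"
begin

datatype 'a ugraph = UGraph (vertices: "'a set") (edges: "'a set set")

definition simple_graph :: "'a ugraph \<Rightarrow> bool" where
  "simple_graph G \<longleftrightarrow> finite (vertices G) \<and> edges G \<subseteq> [vertices G]\<^bsup>2\<^esup>"

definition degree :: "'a ugraph \<Rightarrow> 'a \<Rightarrow> nat" where
  "degree G v = card {e \<in> edges G. v \<in> e}"

text \<open>Subgraphs need not be induced.\<close>

definition subgraph :: "'a ugraph \<Rightarrow> 'a ugraph \<Rightarrow> bool" where
  "subgraph F G \<longleftrightarrow> simple_graph F \<and> vertices F \<subseteq> vertices G \<and> edges F \<subseteq> edges G"

definition isomorphic :: "'a ugraph \<Rightarrow> 'b ugraph \<Rightarrow> bool" where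
  "isomorphic G H \<longleftrightarrow> (\<exists>f. bij_betw f (vertices G) (vertices H) \<and>
     (\<forall>u\<in>vertices G. \<forall>v\<in>vertices G. {u, v} \<in> edges G \<longleftrightarrow> {f u, f v} \<in> edges H))"

definition contains_copy :: "'a ugraph \<Rightarrow> 'b ugraph \<Rightarrow> bool" where
  "contains_copy G H \<longleftrightarrow> (\<exists>F. subgraph F G \<and> isomorphic F H)"

text \<open>
  Every finite graph is isomorphic to one whose vertices are natural numbers, so it suffices
  to let the host graphs range over those.  The set below is empty (and the value unspecified)
  only if \<open>H\<close> is edgeless with at most \<open>n\<close> vertices; see \<open>ex_attained\<close>.
\<close>

definition ex :: "nat \<Rightarrow> 'b ugraph \<Rightarrow> nat" where
  "ex n H = Max {card (edges G) | G :: nat ugraph.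
     simple_graph G \<and> card (vertices G) = n \<and> \<not> contains_copy G H}"

definition H_graph :: "nat \<Rightarrow> nat \<Rightarrow> nat set ugraph" where
  "H_graph l k = UGraph ([{1..k}]\<^bsup>l\<^esup> \<union> [{1..k}]\<^bsup>(k - l)\<^esup>)
     {{S, T} | S T. S \<in> [{1..k}]\<^bsup>l\<^esup> \<and> T \<in> [{1..k}]\<^bsup>(k - l)\<^esup> \<and> S \<subset> T}"

lemma card_nsets:
  assumes "finite A"
  shows "card ([A]\<^bsup>r\<^esup>) = card A choose r"
proof -
  have "[A]\<^bsup>r\<^esup> = {B. B \<subseteq> A \<and> card B = r}"
    using assms by (auto simp: nsets_def intro: finite_subset)
  with n_subsets[OF assms] show ?thesis by simp
qed

lemma finite_ex_set:
  "finite {card (edges G) | G :: nat ugraph.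
     simple_graph G \<and> card (vertices G) = n \<and> \<not> contains_copy G H}"
proof (rule finite_subset)
  have "card (edges G) \<le> n choose 2" if "simple_graph G" "card (vertices G) = n" for G :: "nat ugraph"
    using that card_mono[of "[vertices G]\<^bsup>2\<^esup>" "edges G"]
    by (auto simp: simple_graph_def finite_imp_finite_nsets card_nsets)
  then show "{card (edges G) | G :: nat ugraph.
     simple_graph G \<and> card (vertices G) = n \<and> \<not> contains_copy G H} \<subseteq> {..n choose 2}"
    by auto
qed simp

lemma ex_attained:
  assumes H: "simple_graph H" and e: "edges H \<noteq> {} \<or> n < card (vertices H)"
  obtains G :: "nat ugraph" where "simple_graph G" "card (vertices G) = n"
    "\<not> contains_copy G H" "card (edges G) = ex n H"
proof -
  define G0 :: "nat ugraph" where "G0 = UGraph {..<n} {}"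
  have "simple_graph G0" "card (vertices G0) = n"
    by (auto simp: G0_def simple_graph_def)
  moreover have "\<not> contains_copy G0 H"
  proof
    assume "contains_copy G0 H"
    then obtain F f where F: "vertices F \<subseteq> {..<n}" "edges F = {}"
      and f: "bij_betw f (vertices F) (vertices H)"
      and E: "\<forall>u\<in>vertices F. \<forall>v\<in>vertices F. {f u, f v} \<notin> edges H"
      by (auto simp: contains_copy_def subgraph_def isomorphic_def G0_def)
    have "card (vertices H) \<le> n"
      using F f bij_betw_same_card card_mono[OF _ F(1)] by fastforce
    with e obtain x where x: "x \<in> edges H" by auto
    then have "x \<in> [vertices H]\<^bsup>2\<^esup>" using H by (auto simp: simple_graph_def)
    then obtain a b where "x = {a, b}" "a \<in> vertices H" "b \<in> vertices H"
      by (auto simp: nsets_def card_2_iff)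
    with f E x show False unfolding bij_betw_def by (metis imageE)
  qed
  ultimately have "{card (edges G) | G :: nat ugraph.
     simple_graph G \<and> card (vertices G) = n \<and> \<not> contains_copy G H} \<noteq> {}"
    by auto
  from Max_in[OF finite_ex_set this] that show thesis
    unfolding ex_def by auto
qed

lemma simple_graph_H_graph:
  "simple_graph (H_graph l k)"
proof -
  have "{S, T} \<in> [vertices (H_graph l k)]\<^bsup>2\<^esup>"
    if "S \<in> [{1..k}]\<^bsup>l\<^esup>" "T \<in> [{1..k}]\<^bsup>(k - l)\<^esup>" "S \<subset> T" for S T
    using that by (auto simp: H_graph_def)
  then show ?thesis
    by (auto simp: simple_graph_def H_graph_def finite_imp_finite_nsets)
qed

lemma edge_H_graph_iff:
  "e \<in> edges (H_graph l k) \<longleftrightarrow> (\<exists>S T. e = {S, T} \<and> S \<subseteq> {1..k} \<and> card S = l \<and>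
     T \<subseteq> {1..k} \<and> card T = k - l \<and> S \<subset> T)"
proof -
  have "A \<in> [{1..k}]\<^bsup>r\<^esup> \<longleftrightarrow> A \<subseteq> {1..k} \<and> card A = r" for A r
    unfolding nsets_def using finite_subset[of A "{1..k}"] by blast
  then show ?thesis
    by (simp add: H_graph_def)
qed

lemma H_graph_regular:
  assumes "2 * l < k" and v: "v \<in> vertices (H_graph l k)"
  shows "degree (H_graph l k) v = (k - l) choose l"
proof -
  from v consider "v \<in> [{1..k}]\<^bsup>l\<^esup>" | "v \<in> [{1..k}]\<^bsup>(k - l)\<^esup>"
    by (auto simp: H_graph_def)
  then show ?thesis
  proof cases
    case 1
    then have v: "v \<subseteq> {1..k}" "card v = l" "finite v" by (auto simp: nsets_def)
    have "{e \<in> edges (H_graph l k). v \<in> e} = (\<lambda>U. {v, v \<union> U}) ` [{1..k} - v]\<^bsup>(k - 2 * l)\<^esup>"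
    proof (intro equalityI subsetI)
      fix e assume "e \<in> {e \<in> edges (H_graph l k). v \<in> e}"
      then obtain S T where ST: "e = {S, T}" "card S = l" "T \<subseteq> {1..k}" "card T = k - l" "S \<subset> T"
        and "v = S \<or> v = T"
        unfolding edge_H_graph_iff by blast
      then have "v = S" using assms(1) v by auto
      with ST have T: "e = {v, T}" "T \<subseteq> {1..k}" "card T = k - l" "v \<subset> T"
        by simp_all
      then have "finite T" using finite_subset by blast
      have "T - v \<in> [{1..k} - v]\<^bsup>(k - 2 * l)\<^esup>"
        using T \<open>finite T\<close> v(2,3) by (auto simp: nsets_def card_Diff_subset)
      moreover have "e = {v, v \<union> (T - v)}" using T by auto
      ultimately show "e \<in> (\<lambda>U. {v, v \<union> U}) ` [{1..k} - v]\<^bsup>(k - 2 * l)\<^esup>" by blast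
    next
      fix e assume "e \<in> (\<lambda>U. {v, v \<union> U}) ` [{1..k} - v]\<^bsup>(k - 2 * l)\<^esup>"
      then obtain U where U: "e = {v, v \<union> U}" "U \<subseteq> {1..k} - v" "finite U" "card U = k - 2 * l"
        by (auto simp: nsets_def)
      have "v \<inter> U = {}" using U by auto
      then have c: "card (v \<union> U) = k - l" using U v assms(1) by (simp add: card_Un_disjoint)
      moreover have "v \<union> U \<subseteq> {1..k}" using U(2) v(1) by blast
      moreover have "v \<noteq> v \<union> U" using c v assms(1) by auto
      then have "v \<subset> v \<union> U" by blast
      ultimately have "e \<in> edges (H_graph l k)"
        unfolding edge_H_graph_iff using U(1) v by blast
      with U(1) show "e \<in> {e \<in> edges (H_graph l k). v \<in> e}"
        by simp
    qed
    moreover have "inj_on (\<lambda>U. {v, v \<union> U}) ([{1..k} - v]\<^bsup>(k - 2 * l)\<^esup>)"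
    proof (rule inj_onI)
      fix U W assume UW: "U \<in> [{1..k} - v]\<^bsup>(k - 2 * l)\<^esup>" "W \<in> [{1..k} - v]\<^bsup>(k - 2 * l)\<^esup>"
        and "{v, v \<union> U} = {v, v \<union> W}"
      then have "v \<union> U = v \<union> W" unfolding doubleton_eq_iff by blast
      moreover have "v \<inter> U = {}" "v \<inter> W = {}" using UW by (auto simp: nsets_def)
      ultimately show "U = W" by blast
    qed
    ultimately have "degree (H_graph l k) v = (k - l) choose (k - 2 * l)"
      using v by (simp add: degree_def card_image card_nsets card_Diff_subset)
    also have "\<dots> = (k - l) choose l"
      using assms(1) binomial_symmetric[of l "k - l"] by (simp add: mult_2)
    finally show ?thesis .
  next
    case 2
    then have v: "v \<subseteq> {1..k}" "card v = k - l" "finite v" by (auto simp: nsets_def)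
    have "{e \<in> edges (H_graph l k). v \<in> e} = (\<lambda>S. {S, v}) ` [v]\<^bsup>l\<^esup>"
    proof (intro equalityI subsetI)
      fix e assume "e \<in> {e \<in> edges (H_graph l k). v \<in> e}"
      then obtain S T where ST: "e = {S, T}" "card S = l" "card T = k - l" "S \<subset> T"
        and "v = S \<or> v = T"
        unfolding edge_H_graph_iff by blast
      then have "v = T" using assms(1) v by auto
      with ST have "e = {S, v}" "S \<in> [v]\<^bsup>l\<^esup>"
        using v(3) finite_subset[of S v] by (auto simp: nsets_def)
      then show "e \<in> (\<lambda>S. {S, v}) ` [v]\<^bsup>l\<^esup>" by blast
    next
      fix e assume "e \<in> (\<lambda>S. {S, v}) ` [v]\<^bsup>l\<^esup>"
      then obtain S where S: "e = {S, v}" "S \<subseteq> v" "finite S" "card S = l"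
        by (auto simp: nsets_def)
      moreover have "S \<noteq> v" using S v assms(1) by auto
      ultimately have "S \<subset> v" by blast
      with S(1,4) v have "e \<in> edges (H_graph l k)"
        unfolding edge_H_graph_iff by blast
      with S(1) show "e \<in> {e \<in> edges (H_graph l k). v \<in> e}"
        by simp
    qed
    moreover have "inj_on (\<lambda>S. {S, v}) ([v]\<^bsup>l\<^esup>)"
      by (rule inj_onI) (auto simp: doubleton_eq_iff)
    ultimately show ?thesis
      using v by (simp add: degree_def card_image card_nsets)
  qed
qed

end

theory Submission
  imports Defs "HOL-Library.FuncSet" "HOL-Combinatorics.Transposition" "HOL-Analysis.Convex"
begin

text \<open>
  Let \<open>m = k choose l\<close>, so that \<open>H\<close> has two parts of size \<open>m\<close>, and let \<open>i, j \<in> {1..k}\<close>.  The sets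
  containing both or neither of \<open>i\<close>, \<open>j\<close> separate the sets containing only \<open>i\<close> from those
  containing only \<open>j\<close>, and the transposition of \<open>i\<close> and \<open>j\<close> exchanges the two sides.  Hence
  Cauchy--Schwarz bounds a homomorphism count by the geometric mean of its two foldings.

  Iterated folds have two consequences.  A single edge can be spread over all of \<open>H\<close>, which gives
  Sidorenko's inequality \<open>hom(H, G) \<ge> n\<^sup>2\<^sup>m p\<^sup>m\<^sup>d\<close> for edge density \<open>p\<close>.  And the constraint that two given
  vertices in one part have the same image can be spread over that whole part: if all homomorphisms
  are degenerate, then a constant power of a constant fraction of them map a whole part to a single
  vertex, so that \<open>hom(H, G) \<le> c n \<Delta>\<^sup>m\<close> for maximum degree \<open>\<Delta>\<close>.  When \<open>\<Delta>\<close> is comparable with \<open>p n\<close>, this is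
  a contradiction as soon as \<open>p \<ge> C n powr (- 1 / d - \<epsilon>)\<close> with \<open>\<epsilon> = (m - d) / (d m (d - 1))\<close>, and
  \<open>\<epsilon> > 0\<close> because \<open>d = (k - l) choose l < m\<close>.  The degree assumption is harmless by induction on \<open>n\<close>:
  the few vertices of very high degree meet at most half of the edges, since small vertex sets are
  sparse.
\<close>

section \<open>A Cauchy--Schwarz inequality for reflections\<close>

definition depends_on :: "'a set \<Rightarrow> (('a \<Rightarrow> 'b) \<Rightarrow> bool) \<Rightarrow> bool" where
  "depends_on S P \<longleftrightarrow> (\<forall>f g. (\<forall>x\<in>S. f x = g x) \<longrightarrow> P f = P g)"

lemma depends_onD: "depends_on S P \<Longrightarrow> (\<And>x. x \<in> S \<Longrightarrow> f x = g x) \<Longrightarrow> P f = P g"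
  by (auto simp: depends_on_def)

definition join :: "'a set \<Rightarrow> ('a \<Rightarrow> 'b) \<Rightarrow> ('a \<Rightarrow> 'b) \<Rightarrow> 'a \<Rightarrow> 'b" where
  "join F g h x = (if x \<in> F then g x else h x)"

text \<open>Once the values \<open>g\<close> on \<open>F\<close> are fixed, \<open>P\<close> and
  \<open>Q\<close> constrain the disjoint coordinate sets \<open>L\<close> and \<open>R\<close>
  independently, so the numbers of extensions multiply.\<close>

lemma card_PiE_split:
  assumes fin: "finite V" "finite F" "finite L" "finite R"
    and disj: "F \<inter> L = {}" "F \<inter> R = {}" "L \<inter> R = {}"
    and P: "depends_on (F \<union> L) P" and Q: "depends_on (F \<union> R) Q"
  shows "card {f \<in> (F \<union> L \<union> R) \<rightarrow>\<^sub>E V. P f \<and> Q f} =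
    (\<Sum>g \<in> F \<rightarrow>\<^sub>E V. card {h \<in> L \<rightarrow>\<^sub>E V. P (join F g h)} * card {h \<in> R \<rightarrow>\<^sub>E V. Q (join F g h)})"
proof -
  let ?S = "SIGMA g : F \<rightarrow>\<^sub>E V. {h \<in> L \<rightarrow>\<^sub>E V. P (join F g h)} \<times> {h \<in> R \<rightarrow>\<^sub>E V. Q (join F g h)}"
  let ?m = "\<lambda>(g, h1, h2). join F g (join L h1 h2)"
  let ?i = "\<lambda>f. (restrict f F, restrict f L, restrict f R)"
  have P': "P (join F g (join L h1 h2)) = P (join F g h1)" for g h1 h2
    by (rule depends_onD[OF P]) (auto simp: join_def)
  have Q': "Q (join F g (join L h1 h2)) = Q (join F g h2)" for g h1 h2
    by (rule depends_onD[OF Q]) (use disj in \<open>auto simp: join_def\<close>)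
  have P'': "P (join F (restrict f F) (restrict f L)) = P f" for f
    by (rule depends_onD[OF P]) (auto simp: join_def)
  have Q'': "Q (join F (restrict f F) (restrict f R)) = Q f" for f
    by (rule depends_onD[OF Q]) (auto simp: join_def)
  have "bij_betw ?m ?S {f \<in> (F \<union> L \<union> R) \<rightarrow>\<^sub>E V. P f \<and> Q f}"
  proof (rule bij_betw_byWitness[where f' = ?i])
    show "\<forall>t\<in>?S. ?i (?m t) = t"
      using disj by (auto simp: join_def PiE_def extensional_def restrict_def fun_eq_iff)
    show "\<forall>f\<in>{f \<in> (F \<union> L \<union> R) \<rightarrow>\<^sub>E V. P f \<and> Q f}. ?m (?i f) = f"
      by (auto simp: join_def PiE_def extensional_def restrict_def fun_eq_iff)
    show "?m ` ?S \<subseteq> {f \<in> (F \<union> L \<union> R) \<rightarrow>\<^sub>E V. P f \<and> Q f}"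
      by (auto simp: P' Q') (auto simp: join_def PiE_def extensional_def split: if_splits)
    show "?i ` {f \<in> (F \<union> L \<union> R) \<rightarrow>\<^sub>E V. P f \<and> Q f} \<subseteq> ?S"
      by (auto simp: P'' Q'')
  qed
  then have "card {f \<in> (F \<union> L \<union> R) \<rightarrow>\<^sub>E V. P f \<and> Q f} = card ?S"
    by (simp add: bij_betw_same_card)
  also have "\<dots> = (\<Sum>g \<in> F \<rightarrow>\<^sub>E V. card ({h \<in> L \<rightarrow>\<^sub>E V. P (join F g h)} \<times> {h \<in> R \<rightarrow>\<^sub>E V. Q (join F g h)}))"
    using fin by (intro card_SigmaI) (auto simp: finite_PiE)
  finally show ?thesis
    by (simp add: card_cartesian_product)
qed

text \<open>Composition with \<open>t\<close> turns extensions over \<open>R\<close> into extensions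
  over \<open>L\<close> and leaves the values on \<open>F\<close> unchanged.\<close>

lemma card_PiE_reflect:
  assumes t: "\<And>x. x \<in> L \<Longrightarrow> t x \<in> R" "\<And>x. x \<in> R \<Longrightarrow> t x \<in> L" "\<And>x. x \<in> F \<Longrightarrow> t x = x"
    and inv: "\<And>x. t (t x) = x"
    and disj: "F \<inter> L = {}" "F \<inter> R = {}"
    and P: "depends_on (F \<union> L) P"
  shows "card {h \<in> R \<rightarrow>\<^sub>E V. P (join F g h \<circ> t)} = card {h \<in> L \<rightarrow>\<^sub>E V. P (join F g h)}"
proof -
  have P1: "P (join F g (restrict (h \<circ> t) L)) = P (join F g h \<circ> t)" for h
  proof (rule depends_onD[OF P])
    fix x assume "x \<in> F \<union> L"
    then show "join F g (restrict (h \<circ> t) L) x = (join F g h \<circ> t) x"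
      using t(1)[of x] t(3)[of x] disj by (auto simp: join_def)
  qed
  have P2: "P (join F g (restrict (h \<circ> t) R) \<circ> t) = P (join F g h)" for h
  proof (rule depends_onD[OF P])
    fix x assume "x \<in> F \<union> L"
    then show "(join F g (restrict (h \<circ> t) R) \<circ> t) x = join F g h x"
      using t(1)[of x] t(3)[of x] inv disj by (auto simp: join_def)
  qed
  have "bij_betw (\<lambda>h. restrict (h \<circ> t) L) {h \<in> R \<rightarrow>\<^sub>E V. P (join F g h \<circ> t)}
      {h \<in> L \<rightarrow>\<^sub>E V. P (join F g h)}"
  proof (rule bij_betw_byWitness[where f' = "\<lambda>h. restrict (h \<circ> t) R"])
    show "\<forall>h\<in>{h \<in> R \<rightarrow>\<^sub>E V. P (join F g h \<circ> t)}. restrict (restrict (h \<circ> t) L \<circ> t) R = h"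
      using t inv by (auto simp: PiE_def extensional_def restrict_def fun_eq_iff)
    show "\<forall>h\<in>{h \<in> L \<rightarrow>\<^sub>E V. P (join F g h)}. restrict (restrict (h \<circ> t) R \<circ> t) L = h"
      using t inv by (auto simp: PiE_def extensional_def restrict_def fun_eq_iff)
    show "(\<lambda>h. restrict (h \<circ> t) L) ` {h \<in> R \<rightarrow>\<^sub>E V. P (join F g h \<circ> t)} \<subseteq> {h \<in> L \<rightarrow>\<^sub>E V. P (join F g h)}"
      using t by (auto simp: P1)
    show "(\<lambda>h. restrict (h \<circ> t) R) ` {h \<in> L \<rightarrow>\<^sub>E V. P (join F g h)} \<subseteq> {h \<in> R \<rightarrow>\<^sub>E V. P (join F g h \<circ> t)}"
      using t by (auto simp: P2)
  qed
  then show ?thesis by (rule bij_betw_same_card)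
qed

text \<open>Let \<open>a g\<close> and \<open>b g\<close> count the extensions of \<open>g\<close>
  over \<open>L\<close> and over \<open>R\<close>. The three cardinalities are the sums of
  \<open>a g * b g\<close>, of the squares of \<open>a g\<close> and of the squares of
  \<open>b g\<close>, so this is Cauchy--Schwarz.\<close>

lemma card_PiE_fold:
  assumes fin: "finite V" "finite F" "finite L" "finite R"
    and disj: "F \<inter> L = {}" "F \<inter> R = {}" "L \<inter> R = {}"
    and t: "\<And>x. x \<in> L \<Longrightarrow> t x \<in> R" "\<And>x. x \<in> R \<Longrightarrow> t x \<in> L" "\<And>x. x \<in> F \<Longrightarrow> t x = x"
    and inv: "\<And>x. t (t x) = x"
    and P: "depends_on (F \<union> L) P" and Q: "depends_on (F \<union> R) Q"
  shows "(card {f \<in> (F \<union> L \<union> R) \<rightarrow>\<^sub>E V. P f \<and> Q f})\<^sup>2 \<le>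
    card {f \<in> (F \<union> L \<union> R) \<rightarrow>\<^sub>E V. P f \<and> P (f \<circ> t)} * card {f \<in> (F \<union> L \<union> R) \<rightarrow>\<^sub>E V. Q f \<and> Q (f \<circ> t)}"
proof -
  let ?G = "F \<rightarrow>\<^sub>E V"
  define a where "a g = card {h \<in> L \<rightarrow>\<^sub>E V. P (join F g h)}" for g
  define b where "b g = card {h \<in> R \<rightarrow>\<^sub>E V. Q (join F g h)}" for g
  have P': "depends_on (F \<union> R) (\<lambda>f. P (f \<circ> t))"
    unfolding depends_on_def using t by (intro allI impI depends_onD[OF P]) auto
  have Q': "depends_on (F \<union> L) (\<lambda>f. Q (f \<circ> t))"
    unfolding depends_on_def using t by (intro allI impI depends_onD[OF Q]) auto
  have ra: "card {h \<in> R \<rightarrow>\<^sub>E V. P (join F g h \<circ> t)} = a g" for g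
    unfolding a_def by (rule card_PiE_reflect[OF t inv disj(1,2) P])
  have rb: "card {h \<in> L \<rightarrow>\<^sub>E V. Q (join F g h \<circ> t)} = b g" for g
    unfolding b_def by (rule card_PiE_reflect[OF t(2,1,3) inv disj(2,1) Q])
  have 1: "card {f \<in> (F \<union> L \<union> R) \<rightarrow>\<^sub>E V. P f \<and> Q f} = (\<Sum>g\<in>?G. a g * b g)"
    using card_PiE_split[OF fin disj P Q] by (simp add: a_def b_def)
  have 2: "card {f \<in> (F \<union> L \<union> R) \<rightarrow>\<^sub>E V. P f \<and> P (f \<circ> t)} = (\<Sum>g\<in>?G. (a g)\<^sup>2)"
    using card_PiE_split[OF fin disj P P'] by (simp add: ra) (simp add: a_def power2_eq_square)
  have "card {f \<in> (F \<union> L \<union> R) \<rightarrow>\<^sub>E V. Q (f \<circ> t) \<and> Q f} = (\<Sum>g\<in>?G. (b g)\<^sup>2)"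
    using card_PiE_split[OF fin disj Q' Q] by (simp add: rb) (simp add: b_def power2_eq_square)
  then have 3: "card {f \<in> (F \<union> L \<union> R) \<rightarrow>\<^sub>E V. Q f \<and> Q (f \<circ> t)} = (\<Sum>g\<in>?G. (b g)\<^sup>2)"
    by (simp add: conj_commute)
  have "(\<Sum>g\<in>?G. real (a g) * real (b g))\<^sup>2 \<le> (\<Sum>g\<in>?G. (real (a g))\<^sup>2) * (\<Sum>g\<in>?G. (real (b g))\<^sup>2)"
    by (rule Cauchy_Schwarz_ineq_sum)
  then have "real ((\<Sum>g\<in>?G. a g * b g)\<^sup>2) \<le> real ((\<Sum>g\<in>?G. (a g)\<^sup>2) * (\<Sum>g\<in>?G. (b g)\<^sup>2))"
    by simp
  then show ?thesis
    unfolding 1 2 3 of_nat_le_iff .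
qed

lemma card_PiE_pair:
  assumes E: "E \<subseteq> V \<times> V" and ab: "a \<noteq> b"
  shows "card {h \<in> {a, b} \<rightarrow>\<^sub>E V. (h a, h b) \<in> E} = card E"
proof -
  let ?g = "\<lambda>(x, y) v. if v = a then x else if v = b then y else undefined"
  have "bij_betw (\<lambda>h. (h a, h b)) {h \<in> {a, b} \<rightarrow>\<^sub>E V. (h a, h b) \<in> E} E"
  proof (rule bij_betw_byWitness[where f' = ?g])
    show "\<forall>h\<in>{h \<in> {a, b} \<rightarrow>\<^sub>E V. (h a, h b) \<in> E}. ?g (h a, h b) = h"
      by (auto simp: fun_eq_iff PiE_def extensional_def)
    show "?g ` E \<subseteq> {h \<in> {a, b} \<rightarrow>\<^sub>E V. (h a, h b) \<in> E}"
      using E ab by (auto simp: PiE_def extensional_def)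
  qed (use ab in auto)
  then show ?thesis by (rule bij_betw_same_card)
qed

section \<open>Regularizing digraphs\<close>

text \<open>Blocks of exactly \<open>t\<close> elements are removed until at most \<open>t\<close>
  elements remain; the summand 1 pays for the last block.\<close>

lemma sum_le_by_chunks:
  fixes w :: "'a \<Rightarrow> real"
  assumes "finite S" and t: "1 \<le> t" and M: "0 \<le> M"
    and chunk: "\<And>S'. S' \<subseteq> S \<Longrightarrow> card S' \<le> t \<Longrightarrow> sum w S' \<le> M"
  shows "sum w S \<le> (card S / t + 1) * M"
  using assms(1) chunk
proof (induction S rule: finite_psubset_induct)
  case (psubset S)
  show ?case
  proof (cases "card S \<le> t")
    case True
    then have "sum w S \<le> 1 * M" using psubset.prems by simp
    also have "\<dots> \<le> (card S / t + 1) * M" using M by (intro mult_right_mono) auto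
    finally show ?thesis .
  next
    case False
    then obtain S' where S': "S' \<subseteq> S" "card S' = t" "finite S'"
      using obtain_subset_with_card_n[of t S] by auto
    have "S' \<noteq> {}" using S' t by auto
    then have "S - S' \<subset> S" using S' by blast
    then have "sum w (S - S') \<le> (card (S - S') / t + 1) * M"
      using psubset.prems by (intro psubset.IH) auto
    moreover have "real (card (S - S')) = real (card S) - real t"
      using S' False by (simp add: card_Diff_subset of_nat_diff)
    then have "card (S - S') / t + 1 = card S / t"
      using t by (simp add: diff_divide_distrib)
    moreover have "sum w S' \<le> M" using psubset.prems S' by simp
    moreover have "sum w S = sum w S' + sum w (S - S')"
      using sum.subset_diff[OF S'(1) psubset.hyps(1), of w] by simp
    ultimately show ?thesis by (simp add: distrib_right)
  qed
qed

lemma card_separating_subsets: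
  assumes "finite V" "u \<in> V" "v \<in> V" "u \<noteq> v"
  shows "4 * card {X \<in> Pow V. u \<in> X \<and> v \<notin> X} = 2 ^ card V"
proof -
  have "{X \<in> Pow V. u \<in> X \<and> v \<notin> X} = insert u ` Pow (V - {u, v})"
  proof
    show "{X \<in> Pow V. u \<in> X \<and> v \<notin> X} \<subseteq> insert u ` Pow (V - {u, v})"
    proof
      fix X assume "X \<in> {X \<in> Pow V. u \<in> X \<and> v \<notin> X}"
      then have "X = insert u (X - {u})" "X - {u} \<in> Pow (V - {u, v})" by auto
      then show "X \<in> insert u ` Pow (V - {u, v})" by (rule image_eqI)
    qed
  qed (use assms in auto)
  moreover have "inj_on (insert u) (Pow (V - {u, v}))"
    by (rule inj_onI) blast
  ultimately have "card {X \<in> Pow V. u \<in> X \<and> v \<notin> X} = 2 ^ card (V - {u, v})"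
    using assms by (simp add: card_image card_Pow)
  moreover have "card V = card (V - {u, v}) + 2"
    using assms card_mono[of V "{u, v}"] by (simp add: card_Diff_subset)
  ultimately show ?thesis by (simp add: power_add)
qed

text \<open>A uniformly random \<open>X\<close> contains the tail and misses the head of a given arc
  with probability 1/4, so some \<open>X\<close> reaches the average. The cut makes the host
  bipartite, so that homomorphisms send the two layers of the pattern into disjoint sets.\<close>

lemma ex_directed_cut:
  assumes V: "finite V" and E: "E \<subseteq> V \<times> V" and irr: "\<And>v. (v, v) \<notin> E"
  obtains X where "X \<subseteq> V" "card E \<le> 4 * card (E \<inter> X \<times> (V - X))"
proof (rule ccontr)
  assume no: "\<not> thesis"
  have finE: "finite E" using E V finite_subset by blast
  have "(\<Sum>X\<in>Pow V. 4 * card (E \<inter> X \<times> (V - X))) < (\<Sum>X\<in>Pow V. card E)"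
    using V no that by (intro sum_strict_mono) (auto simp: not_le[symmetric])
  also have "\<dots> = (\<Sum>e\<in>E. 2 ^ card V)" using V by (simp add: card_Pow)
  also have "\<dots> = (\<Sum>e\<in>E. 4 * card {X \<in> Pow V. fst e \<in> X \<and> snd e \<notin> X})"
  proof (rule sum.cong[OF refl])
    fix e assume "e \<in> E"
    moreover obtain u v where "e = (u, v)" by force
    ultimately show "2 ^ card V = 4 * card {X \<in> Pow V. fst e \<in> X \<and> snd e \<notin> X}"
      using E irr by (intro card_separating_subsets[symmetric] V) auto
  qed
  also have "\<dots> = 4 * (\<Sum>e\<in>E. \<Sum>X\<in>Pow V. of_bool (fst e \<in> X \<and> snd e \<notin> X))"
    using V by (simp add: sum_distrib_left Int_def)
  also have "\<dots> = 4 * (\<Sum>X\<in>Pow V. \<Sum>e\<in>E. of_bool (fst e \<in> X \<and> snd e \<notin> X))"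
    by (subst sum.swap) simp
  also have "\<dots> = (\<Sum>X\<in>Pow V. 4 * card (E \<inter> X \<times> (V - X)))"
  proof -
    have "(\<Sum>e\<in>E. of_bool (fst e \<in> X \<and> snd e \<notin> X)) = card (E \<inter> X \<times> (V - X))" for X
    proof -
      have "E \<inter> X \<times> (V - X) = E \<inter> {e. fst e \<in> X \<and> snd e \<notin> X}" using E by auto
      then show ?thesis using finE by simp
    qed
    then show ?thesis by (simp add: sum_distrib_left)
  qed
  finally show False by simp
qed

lemma card_Int_Times_right:
  assumes "finite E" "finite B"
  shows "card (E \<inter> A \<times> B) = (\<Sum>v\<in>B. card (E \<inter> A \<times> {v}))"
proof -
  have "E \<inter> A \<times> B = (\<Union>v\<in>B. E \<inter> A \<times> {v})" by auto
  also have "card \<dots> = (\<Sum>v\<in>B. card (E \<inter> A \<times> {v}))"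
    using assms by (intro card_UN_disjoint) auto
  finally show ?thesis .
qed

lemma card_Int_Times_left:
  assumes "finite E" "finite B"
  shows "card (E \<inter> B \<times> A) = (\<Sum>v\<in>B. card (E \<inter> {v} \<times> A))"
proof -
  have "E \<inter> B \<times> A = (\<Union>v\<in>B. E \<inter> {v} \<times> A)" by auto
  also have "card \<dots> = (\<Sum>v\<in>B. card (E \<inter> {v} \<times> A))"
    using assms by (intro card_UN_disjoint) auto
  finally show ?thesis .
qed

text \<open>Give each vertex the number of arcs between it and \<open>T\<close> as weight. For a
  chunk \<open>S\<close> these arcs lie inside \<open>S \<union> T\<close>, at most \<open>M\<close>
  in each direction, and the chunks add up.\<close>

lemma card_touching_le:
  fixes M :: real
  assumes V: "finite V" and E: "E \<subseteq> V \<times> V" and T: "T \<subseteq> V" and t: "1 \<le> t"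
    and dense: "\<And>S. S \<subseteq> V \<Longrightarrow> card S \<le> t \<Longrightarrow> card (E \<inter> (S \<union> T) \<times> (S \<union> T)) \<le> M"
  shows "card {e \<in> E. fst e \<in> T \<or> snd e \<in> T} \<le> (card V / t + 1) * (2 * M)"
proof -
  have finE: "finite E" using E V finite_subset by blast
  define w where "w v = real (card (E \<inter> T \<times> {v}) + card (E \<inter> {v} \<times> T))" for v
  have w: "sum w S = real (card (E \<inter> T \<times> S) + card (E \<inter> S \<times> T))" if "S \<subseteq> V" for S
    using that finE V finite_subset[OF that V]
    by (simp add: w_def card_Int_Times_right[of E S T] card_Int_Times_left[of E S T] sum.distrib)
  have "sum w V \<le> (card V / t + 1) * (2 * M)"
  proof (rule sum_le_by_chunks[OF V t])
    have "0 \<le> M" using dense[of "{}"] by (rule order_trans[rotated]) auto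
    then show "0 \<le> 2 * M" by simp
    fix S assume S: "S \<subseteq> V" "card S \<le> t"
    have "card (E \<inter> T \<times> S) \<le> card (E \<inter> (S \<union> T) \<times> (S \<union> T))"
      "card (E \<inter> S \<times> T) \<le> card (E \<inter> (S \<union> T) \<times> (S \<union> T))"
      using finE by (auto intro!: card_mono)
    then show "sum w S \<le> 2 * M"
      using dense[OF S] by (simp add: w[OF S(1)])
  qed
  moreover have "card {e \<in> E. fst e \<in> T \<or> snd e \<in> T} \<le> card (E \<inter> T \<times> V) + card (E \<inter> V \<times> T)"
  proof -
    have "{e \<in> E. fst e \<in> T \<or> snd e \<in> T} = (E \<inter> T \<times> V) \<union> (E \<inter> V \<times> T)" using E by auto
    then show ?thesis by (simp add: card_Un_le)
  qed
  ultimately show ?thesis by (simp add: w)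
qed

text \<open>Markov's inequality: in-degrees and out-degrees together sum to
  \<open>2 * card E\<close>.\<close>

lemma card_high_degree_le:
  fixes \<tau> :: real
  assumes V: "finite V" and E: "E \<subseteq> V \<times> V"
  shows "card {v \<in> V. card (E `` {v}) + card (E\<inverse> `` {v}) > \<tau>} * \<tau> \<le> 2 * card E"
proof -
  have finE: "finite E" using E V finite_subset by blast
  define T where "T = {v \<in> V. card (E `` {v}) + card (E\<inverse> `` {v}) > \<tau>}"
  have out: "card (E `` {v}) = card (E \<inter> {v} \<times> V)" for v
  proof -
    have "E \<inter> {v} \<times> V = Pair v ` (E `` {v})" using E by auto
    then show ?thesis by (simp add: card_image inj_on_def)
  qed
  have into: "card (E\<inverse> `` {v}) = card (E \<inter> V \<times> {v})" for v
  proof -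
    have "E \<inter> V \<times> {v} = (\<lambda>u. (u, v)) ` (E\<inverse> `` {v})" using E by auto
    then show ?thesis by (simp add: card_image inj_on_def)
  qed
  have EV: "E \<inter> V \<times> V = E" using E by auto
  have "card T * \<tau> = (\<Sum>v\<in>T. \<tau>)" by simp
  also have "\<dots> \<le> (\<Sum>v\<in>T. real (card (E `` {v}) + card (E\<inverse> `` {v})))"
    by (rule sum_mono) (auto simp: T_def)
  also have "\<dots> \<le> (\<Sum>v\<in>V. real (card (E `` {v}) + card (E\<inverse> `` {v})))"
    using V by (intro sum_mono2) (auto simp: T_def)
  also have "\<dots> = card (E \<inter> V \<times> V) + card (E \<inter> V \<times> V)"
    using arg_cong[OF card_Int_Times_left[OF finE V, of V], of real]
      arg_cong[OF card_Int_Times_right[OF finE V, of V], of real]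
    by (simp only: out into sum.distrib of_nat_add of_nat_sum)
  finally show ?thesis by (simp add: T_def EV)
qed

text \<open>Delete the edges at the set \<open>T\<close> of vertices of high degree.  They are few: \<open>T\<close> together with any
  chunk of about \<open>card V / K\<close> vertices is small, hence sparse, and about \<open>K\<close> chunks cover \<open>V\<close>.\<close>

lemma ex_degree_bounded_subgraph:
  fixes R \<beta> :: real and K :: nat
  assumes V: "finite V" and E: "E \<subseteq> V \<times> V" and K: "3 \<le> K" "K \<le> card V"
    and \<beta>: "1 < \<beta>" "\<beta> \<le> 2" and K\<beta>: "48 \<le> real K powr (\<beta> - 1)" and R: "0 < R"
    and sparse: "\<And>W. W \<subseteq> V \<Longrightarrow> card W < card V \<Longrightarrow> card (E \<inter> W \<times> W) \<le> R * card W powr \<beta>"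
    and big: "R * card V powr \<beta> < card E"
  obtains E' where "E' \<subseteq> E" "card E \<le> 2 * card E'"
    "\<And>v. card (E' `` {v}) \<le> 2 * K * card E / card V"
    "\<And>v. card (E'\<inverse> `` {v}) \<le> 2 * K * card E / card V"
proof -
  define n where "n = card V"
  define t where "t = n div K"
  define \<tau> where "\<tau> = 2 * real K * card E / n"
  define T where "T = {v \<in> V. card (E `` {v}) + card (E\<inverse> `` {v}) > \<tau>}"
  define B where "B = {e \<in> E. fst e \<in> T \<or> snd e \<in> T}"
  have finE: "finite E" using E V finite_subset by blast
  have n: "0 < n" "K \<le> n" using K by (auto simp: n_def)
  have "0 \<le> R * card V powr \<beta>" using R by simp
  then have e: "0 < real (card E)" using big by linarith
  have t: "1 \<le> t" "t * K \<le> n" "n < (t + 1) * K"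
  proof -
    show "1 \<le> t" using K n by (simp add: t_def Suc_le_eq div_greater_zero_iff)
    show "t * K \<le> n" by (simp add: t_def)
    show "n < (t + 1) * K" using K by (simp add: t_def dividend_less_div_times)
  qed
  \<comment> \<open>The threshold \<open>\<tau>\<close> is \<open>K\<close> times
    \<open>2 * card E / n\<close>, the mean of in-degree plus out-degree, so at most
    \<open>n / K\<close> vertices exceed it.\<close>
  have "real (card T) * K \<le> n"
    using card_high_degree_le[OF V E, of \<tau>] e n(1) unfolding T_def[symmetric]
    by (simp add: \<tau>_def field_simps)
  then have "card T * K \<le> n" by (simp flip: of_nat_mult)
  then have T: "card T \<le> t" using K by (simp add: t_def less_eq_div_iff_mult_less_eq)
  have "T \<subseteq> V" by (auto simp: T_def)
  \<comment> \<open>Here \<open>3 \<le> K\<close> is used: \<open>S \<union> T\<close> has at most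
    \<open>2 * t < n\<close> vertices, so \<open>sparse\<close> applies to it.\<close>
  have "3 * t \<le> t * K" using K by simp
  then have t2: "2 * t < n" using t by linarith
  have "card B \<le> (card V / t + 1) * (2 * (R * (2 * n / K) powr \<beta>))"
    unfolding B_def
  proof (rule card_touching_le[OF V E \<open>T \<subseteq> V\<close> t(1)])
    fix S assume S: "S \<subseteq> V" "card S \<le> t"
    have c: "card (S \<union> T) \<le> 2 * t" using card_Un_le[of S T] S T by linarith
    then have "card (E \<inter> (S \<union> T) \<times> (S \<union> T)) \<le> R * card (S \<union> T) powr \<beta>"
      using S \<open>T \<subseteq> V\<close> t2 by (intro sparse) (auto simp: n_def)
    also have "\<dots> \<le> R * (2 * n / K) powr \<beta>"
    proof (intro mult_left_mono powr_mono2)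
      have "real (card (S \<union> T)) \<le> 2 * real t" using c by linarith
      also have "real t * K \<le> n" using t(2) by (simp flip: of_nat_mult)
      then have "2 * real t \<le> 2 * n / K" using K by (simp add: field_simps)
      finally show "real (card (S \<union> T)) \<le> 2 * n / K" .
    qed (use \<beta> R in auto)
    finally show "card (E \<inter> (S \<union> T) \<times> (S \<union> T)) \<le> R * (2 * n / K) powr \<beta>" .
  qed
  also have "\<dots> \<le> (3 * K) * (2 * (R * (2 * n / K) powr \<beta>))"
  proof (rule mult_right_mono)
    have "(t + 1) * K \<le> (2 * t) * K" using t(1) by (intro mult_right_mono) auto
    then have "n \<le> 2 * t * K" using t(3) by linarith
    then have "real n \<le> 2 * t * K" by (metis of_nat_le_iff of_nat_mult of_nat_numeral)
    then have "card V / t \<le> 2 * K" using t(1) by (simp add: n_def field_simps)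
    then show "card V / t + 1 \<le> 3 * K" using K by simp
  qed (use R in simp)
  also have "\<dots> = 6 * 2 powr \<beta> / K powr (\<beta> - 1) * (R * n powr \<beta>)"
    using K n by (simp add: powr_mult powr_divide powr_diff)
  \<comment> \<open>The constant 48 is chosen to make this factor 1/2, so that at most half of the
    arcs are deleted.\<close>
  also have "\<dots> \<le> 6 * 4 / 48 * (R * n powr \<beta>)"
  proof (intro mult_right_mono frac_le mult_left_mono)
    have "2 powr \<beta> \<le> 2 powr 2" using \<beta> by (intro powr_mono) auto
    then show "2 powr \<beta> \<le> 4" by simp
  qed (use K\<beta> R in auto)
  finally have B: "2 * real (card B) \<le> card E"
    using big by (simp add: n_def)
  have "B \<subseteq> E" by (auto simp: B_def)
  then have cB: "card (E - B) = card E - card B" "card B \<le> card E"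
    using finE by (auto intro: card_mono card_Diff_subset finite_subset)
  have deg: "card (E `` {v}) + card (E\<inverse> `` {v}) \<le> \<tau>" if "v \<in> V" "v \<notin> T" for v
    using that by (auto simp: T_def)
  have fin_image: "finite (E `` {v})" "finite (E\<inverse> `` {v})" for v
    using E V by (auto intro!: finite_subset[of _ V])
  have \<tau>0: "0 \<le> \<tau>" by (simp add: \<tau>_def)
  show thesis
  proof (rule that[of "E - B"])
    show "card E \<le> 2 * card (E - B)" using B cB by linarith
    fix v
    have "(E - B) `` {v} = {} \<and> (E - B)\<inverse> `` {v} = {}" if "\<not> (v \<in> V \<and> v \<notin> T)"
      using that E by (auto simp: B_def)
    moreover have "card ((E - B) `` {v}) \<le> card (E `` {v})" "card ((E - B)\<inverse> `` {v}) \<le> card (E\<inverse> `` {v})"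
      using fin_image by (auto intro!: card_mono)
    ultimately have "card ((E - B) `` {v}) \<le> \<tau> \<and> card ((E - B)\<inverse> `` {v}) \<le> \<tau>"
      using deg[of v] \<tau>0 by (cases "v \<in> V \<and> v \<notin> T") auto
    then show "card ((E - B) `` {v}) \<le> 2 * K * card E / card V"
      "card ((E - B)\<inverse> `` {v}) \<le> 2 * K * card E / card V"
      by (auto simp: \<tau>_def n_def)
  qed auto
qed

text \<open>Cancelling \<open>e ^ m\<close> from \<open>main\<close> leaves \<open>e ^ p\<close>
  with \<open>p = m * d - m\<close>. The equation for \<open>\<beta>\<close> says exactly that
  inserting \<open>R * n powr \<beta>\<close> for \<open>e\<close> makes all powers of
  \<open>n\<close> cancel, which leaves a bound on \<open>R ^ p\<close> and hence on
  \<open>R\<close>.\<close>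

lemma density_arith:
  fixes e n c K R \<beta> :: real and m d :: nat
  assumes d: "2 \<le> d" and m: "1 \<le> m" and n: "1 \<le> n" and R: "1 \<le> R" and K: "0 < K"
    and e: "e > R * n powr \<beta>"
    and \<beta>: "\<beta> * (real m * real d - real m) = 2 * real m * real d - 3 * real m + 1"
    and main: "(e / (8 * n\<^sup>2)) ^ (m * d) \<le> c * (n * (2 * K * e / n) ^ m) / n ^ (2 * m)"
  shows "R < c * 8 ^ (m * d) * (2 * K) ^ m"
proof -
  define p where "p = m * d - m"
  have "m * 2 \<le> m * d" using d by simp
  \<comment> \<open>The last conjunct makes the natural subtraction in the exponent
    \<open>2 * (m * d) + 1 - 3 * m\<close> exact.\<close>
  then have p: "m * d = p + m" "1 \<le> p" "3 * m \<le> 2 * (m * d)" using m unfolding p_def by linarith+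
  have n0: "n > 0" using n by simp
  have npos: "n powr \<beta> > 0" using n0 by simp
  then have e0: "e > 0" using e R by (smt (verit) mult_nonneg_nonneg)
  have "(n powr \<beta>) ^ p = n powr (\<beta> * p)"
    using n0 by (simp add: powr_powr flip: powr_realpow)
  also have "\<beta> * p = real (2 * (m * d) + 1 - 3 * m)"
  proof -
    have "real (m * d) = real (p + m)" using p(1) by (rule arg_cong)
    then have "real p = real m * real d - real m" by simp
    moreover have "real (2 * (m * d) + 1 - 3 * m) = real (2 * (m * d) + 1) - real (3 * m)"
      using p(3) by (intro of_nat_diff) linarith
    ultimately show ?thesis using \<beta> by simp
  qed
  also have "n powr real (2 * (m * d) + 1 - 3 * m) = n ^ (2 * (m * d) + 1 - 3 * m)"
    using n0 by (rule powr_realpow)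
  finally have np0: "(n powr \<beta>) ^ p = n ^ (2 * (m * d) + 1 - 3 * m)" .
  have np: "(n powr \<beta>) ^ p * n ^ (3 * m) = n ^ (2 * (m * d) + 1)"
      proof -
    have "2 * (m * d) + 1 - 3 * m + 3 * m = 2 * (m * d) + 1" using p(3) by linarith
    then show ?thesis by (simp only: np0 power_add[symmetric])
  qed
  have "(e / (8 * n\<^sup>2)) ^ (m * d) = e ^ p * e ^ m / (8 ^ (m * d) * n ^ (2 * (m * d)))"
    by (simp add: power_divide power_mult_distrib p(1) power_add flip: power_mult)
  moreover have "c * (n * (2 * K * e / n) ^ m) / n ^ (2 * m) = c * (2 * K) ^ m * e ^ m * n / n ^ (3 * m)"
  proof -
    have "n ^ (3 * m) = n ^ m * n ^ (2 * m)" by (simp flip: power_add)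
    then show ?thesis by (simp add: power_divide power_mult_distrib)
  qed
  ultimately have "e ^ p * e ^ m / (8 ^ (m * d) * n ^ (2 * (m * d))) \<le> c * (2 * K) ^ m * e ^ m * n / n ^ (3 * m)"
    using main by simp
  then have "e ^ p * n ^ (3 * m) \<le> (c * 8 ^ (m * d) * (2 * K) ^ m) * n ^ (2 * (m * d) + 1)"
    using e0 n0 by (simp add: field_simps)
  moreover have "(R * n powr \<beta>) ^ p < e ^ p"
    using e R npos p(2) by (intro power_strict_mono) auto
  then have "R ^ p * (n powr \<beta>) ^ p * n ^ (3 * m) < e ^ p * n ^ (3 * m)"
    using n0 by (simp add: power_mult_distrib)
  ultimately have "R ^ p * n ^ (2 * (m * d) + 1) < (c * 8 ^ (m * d) * (2 * K) ^ m) * n ^ (2 * (m * d) + 1)"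
    using np by (simp add: mult.assoc)
  then have "R ^ p < c * 8 ^ (m * d) * (2 * K) ^ m"
    using n0 by simp
  moreover have "R \<le> R ^ p" using R p(2) by (intro self_le_power) auto
  ultimately show ?thesis by simp
qed

section \<open>Shifting sets\<close>

text \<open>The compression operator of extremal set theory, which replaces \<open>j\<close> by
  \<open>i\<close> where possible. Written with the transposition, it folds the sets containing only
  \<open>j\<close> onto those containing only \<open>i\<close>.\<close>

definition shift :: "nat \<Rightarrow> nat \<Rightarrow> nat set \<Rightarrow> nat set" where
  "shift i j v = (if j \<in> v \<and> i \<notin> v then transpose i j ` v else v)"

lemma card_transpose_image [simp]: "card (transpose i j ` v) = card v"
  by (simp add: card_image)

lemma transpose_image_image [simp]: "transpose i j ` transpose i j ` v = v"
  by (simp add: image_image)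

lemma transpose_image_subset:
  "i \<in> W \<Longrightarrow> j \<in> W \<Longrightarrow> v \<subseteq> W \<Longrightarrow> transpose i j ` v \<subseteq> W"
  by (auto simp: transpose_def)

lemma mem_transpose_image [simp]:
  "i \<in> transpose i j ` v \<longleftrightarrow> j \<in> v" "j \<in> transpose i j ` v \<longleftrightarrow> i \<in> v"
  by (auto simp: in_transpose_image_iff)

lemma card_shift [simp]: "card (shift i j v) = card v"
  by (simp add: shift_def)

lemma shift_subset: "i \<in> W \<Longrightarrow> j \<in> W \<Longrightarrow> v \<subseteq> W \<Longrightarrow> shift i j v \<subseteq> W"
  using transpose_image_subset[of i W j v] by (simp add: shift_def)

lemma shift_eq_transpose: "(i \<in> v \<Longrightarrow> j \<in> v) \<Longrightarrow> shift i j v = transpose i j ` v"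
  by (cases "i \<in> v"; cases "j \<in> v") (simp_all add: shift_def)

lemma mem_shift_other: "x \<noteq> i \<Longrightarrow> x \<noteq> j \<Longrightarrow> x \<in> shift i j v \<longleftrightarrow> x \<in> v"
  by (auto simp: shift_def in_transpose_image_iff)

lemma mem_shift_target: "i \<in> shift i j v \<longleftrightarrow> i \<in> v \<or> j \<in> v"
  by (auto simp: shift_def)

text \<open>This makes shifts endomorphisms of the inclusion graph. The delicate element is
  \<open>j\<close>, which survives in \<open>shift i j S\<close> only if both \<open>i\<close> and
  \<open>j\<close> lie in \<open>S\<close>, hence in \<open>T\<close>.\<close>

lemma shift_mono: "S \<subseteq> T \<Longrightarrow> shift i j S \<subseteq> shift i j T"
proof
  fix x assume "S \<subseteq> T" "x \<in> shift i j S"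
  then show "x \<in> shift i j T"
    by (cases "x = i"; cases "x = j")
      (auto simp: mem_shift_target mem_shift_other, auto simp: shift_def split: if_splits)
qed

fun shifts :: "(nat \<times> nat) list \<Rightarrow> nat set \<Rightarrow> nat set" where
  "shifts [] v = v"
| "shifts (p # ps) v = shift (fst p) (snd p) (shifts ps v)"

lemma card_shifts [simp]: "card (shifts ps v) = card v"
  by (induction ps) auto

lemma shifts_subset: "set ps \<subseteq> W \<times> W \<Longrightarrow> v \<subseteq> W \<Longrightarrow> shifts ps v \<subseteq> W"
proof (induction ps)
  case (Cons p ps)
  then show ?case using shift_subset[of "fst p" W "snd p" "shifts ps v"] by auto
qed simp

lemma shifts_append: "shifts (ps @ qs) v = shifts ps (shifts qs v)"
  by (induction ps) auto

lemma shift_keep: "x \<noteq> j \<Longrightarrow> x \<in> v \<Longrightarrow> x \<in> shift i j v"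
  by (cases "x = i") (auto simp: mem_shift_target mem_shift_other)

lemma shifts_id: "v \<inter> snd ` set ps = {} \<Longrightarrow> shifts ps v = v"
  by (induction ps) (auto simp: shift_def)

lemma shifts_keep: "x \<notin> snd ` set ps \<Longrightarrow> x \<in> v \<Longrightarrow> x \<in> shifts ps v"
  by (induction ps) (auto intro: shift_keep)

lemma shifts_collect_one:
  assumes "s \<notin> set cs" "s \<in> v \<or> (\<exists>c\<in>set cs. c \<in> v)"
  shows "s \<in> shifts (map (Pair s) cs) v"
  using assms
proof (induction cs)
  case (Cons c cs)
  show ?case
  proof (cases "s \<in> v \<or> (\<exists>c\<in>set cs. c \<in> v)")
    case True
    then show ?thesis using Cons by (simp add: mem_shift_target)
  next
    case False
    then have "c \<in> v" using Cons by auto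
    then have "c \<in> shifts (map (Pair s) cs) v \<or> s \<in> shifts (map (Pair s) cs) v"
      using False by (intro disjI1 shifts_keep) (auto)
    then show ?thesis by (auto simp: mem_shift_target)
  qed
qed simp

text \<open>The elements \<open>s\<close> of \<open>U\<close> are secured one at a time by shifting
  every element outside \<open>U\<close> towards \<open>s\<close>. A set with at least
  \<open>card U\<close> elements cannot lie inside \<open>U - {s}\<close>, so it contains
  \<open>s\<close> or something to shift. Only elements outside \<open>U\<close> are ever removed,
  so what is secured stays.\<close>

lemma shifts_collect:
  assumes W: "finite W" and U: "U \<subseteq> W"
  obtains ps where "set ps \<subseteq> U \<times> (W - U)"
    and "\<And>v. v \<subseteq> W \<Longrightarrow> card U \<le> card v \<Longrightarrow> U \<subseteq> shifts ps v"
proof -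
  have "finite U" using W U finite_subset by auto
  have "\<exists>ps. set ps \<subseteq> U \<times> (W - U) \<and> (\<forall>v \<subseteq> W. card U \<le> card v \<longrightarrow> U' \<subseteq> shifts ps v)"
    if "U' \<subseteq> U" for U'
    using finite_subset[OF that \<open>finite U\<close>] that
  proof (induction U')
    case empty
    show ?case by (rule exI[of _ "[]"]) auto
  next
    case (insert s U')
    then obtain ps where ps: "set ps \<subseteq> U \<times> (W - U)"
      and ps': "\<And>v. v \<subseteq> W \<Longrightarrow> card U \<le> card v \<Longrightarrow> U' \<subseteq> shifts ps v"
      by auto
    obtain cs where cs: "set cs = W - U"
      using W finite_list[of "W - U"] by auto
    define qs where "qs = map (Pair s) cs @ ps"
    have "insert s U' \<subseteq> shifts qs v" if v: "v \<subseteq> W" "card U \<le> card v" for v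
    proof -
      define v' where "v' = shifts ps v"
      have v': "v' \<subseteq> W" "card v' = card v" "U' \<subseteq> v'"
        using ps ps'[OF v] U v(1) using shifts_subset[of ps W v] by (auto simp: v'_def)
      have "s \<in> v' \<or> (\<exists>c\<in>set cs. c \<in> v')"
      proof (rule ccontr)
        assume no: "\<not> (s \<in> v' \<or> (\<exists>c\<in>set cs. c \<in> v'))"
        then have "v' \<subseteq> U - {s}" using v'(1) cs by auto
        then have "card v' \<le> card (U - {s})"
          using \<open>finite U\<close> by (intro card_mono) auto
        then show False
          using v'(2) v(2) insert.prems \<open>finite U\<close> card_Diff1_less[of U s] by auto
      qed
      then have "s \<in> shifts (map (Pair s) cs) v'"
        using insert.prems cs by (intro shifts_collect_one) auto
      moreover have "U' \<subseteq> shifts (map (Pair s) cs) v'"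
        using v'(3) insert.prems cs by (auto intro!: shifts_keep)
      ultimately show ?thesis
        by (simp add: qs_def shifts_append v'_def)
    qed
    moreover have "set qs \<subseteq> U \<times> (W - U)"
      using ps cs insert.prems by (auto simp: qs_def)
    ultimately show ?case by blast
  qed
  from this[of U] that show thesis by blast
qed

section \<open>Folding homomorphism counts\<close>

locale subset_layers =
  fixes k l :: nat
  assumes l_pos: "1 \<le> l" and l_less: "2 * l < k"
begin

definition lower :: "nat set set" where "lower = {S. S \<subseteq> {1..k} \<and> card S = l}"
definition upper :: "nat set set" where "upper = {T. T \<subseteq> {1..k} \<and> card T = k - l}"
definition verts :: "nat set set" where "verts = lower \<union> upper"
definition incl :: "(nat set \<times> nat set) set" where
  "incl = {(S, T). S \<in> lower \<and> T \<in> upper \<and> S \<subseteq> T}"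

lemma finite_layers [simp]: "finite lower" "finite upper" "finite verts" "finite incl"
proof -
  show a: "finite lower" "finite upper"
    by (auto simp: lower_def upper_def)
  then show "finite verts" by (simp add: verts_def)
  from a show "finite incl"
    by (intro finite_subset[of incl "lower \<times> upper"]) (auto simp: incl_def)
qed

lemma layers_disjoint: "lower \<inter> upper = {}"
  using l_less by (auto simp: lower_def upper_def)

lemma transpose_layers:
  assumes "i \<in> {1..k}" "j \<in> {1..k}"
  shows "v \<in> lower \<Longrightarrow> transpose i j ` v \<in> lower" "v \<in> upper \<Longrightarrow> transpose i j ` v \<in> upper"
    "v \<in> verts \<Longrightarrow> transpose i j ` v \<in> verts"
    "(S, T) \<in> incl \<Longrightarrow> (transpose i j ` S, transpose i j ` T) \<in> incl"
proof -
  show lo: "v \<in> lower \<Longrightarrow> transpose i j ` v \<in> lower" for v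
    using transpose_image_subset[OF assms, of v]
    unfolding lower_def mem_Collect_eq card_transpose_image by blast
  show up: "v \<in> upper \<Longrightarrow> transpose i j ` v \<in> upper" for v
    using transpose_image_subset[OF assms, of v]
    unfolding upper_def mem_Collect_eq card_transpose_image by blast
  show "v \<in> verts \<Longrightarrow> transpose i j ` v \<in> verts"
    using lo up unfolding verts_def by blast
  show "(S, T) \<in> incl \<Longrightarrow> (transpose i j ` S, transpose i j ` T) \<in> incl"
    using lo up image_mono[of S T] unfolding incl_def mem_Collect_eq prod.case by blast
qed

lemma shift_layers:
  assumes "i \<in> {1..k}" "j \<in> {1..k}"
  shows "v \<in> lower \<Longrightarrow> shift i j v \<in> lower" "v \<in> upper \<Longrightarrow> shift i j v \<in> upper"
    "v \<in> verts \<Longrightarrow> shift i j v \<in> verts"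
    "(S, T) \<in> incl \<Longrightarrow> (shift i j S, shift i j T) \<in> incl"
proof -
  show lo: "v \<in> lower \<Longrightarrow> shift i j v \<in> lower" for v
    using shift_subset[OF assms, of v]
    unfolding lower_def mem_Collect_eq card_shift by blast
  show up: "v \<in> upper \<Longrightarrow> shift i j v \<in> upper" for v
    using shift_subset[OF assms, of v]
    unfolding upper_def mem_Collect_eq card_shift by blast
  show "v \<in> verts \<Longrightarrow> shift i j v \<in> verts"
    using lo up unfolding verts_def by blast
  show "(S, T) \<in> incl \<Longrightarrow> (shift i j S, shift i j T) \<in> incl"
    using lo up shift_mono[of S T] unfolding incl_def mem_Collect_eq prod.case by blast
qed

text \<open>Two kinds of constraint share one folding lemma: Sidorenko's inequality varies
  \<open>J\<close> with \<open>Z\<close> empty, and the study of degenerate homomorphisms varies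
  \<open>Z\<close> with \<open>J = incl\<close>.\<close>

definition compat :: "('v \<times> 'v) set \<Rightarrow> (nat set \<times> nat set) set \<Rightarrow> nat set set \<Rightarrow> (nat set \<Rightarrow> 'v) \<Rightarrow> bool" where
  "compat E J Z f \<longleftrightarrow> (\<forall>(a, b)\<in>J. (f a, f b) \<in> E) \<and> (\<forall>x\<in>Z. \<forall>y\<in>Z. f x = f y)"

definition maps :: "'v set \<Rightarrow> ('v \<times> 'v) set \<Rightarrow> (nat set \<times> nat set) set \<Rightarrow> nat set set \<Rightarrow> (nat set \<Rightarrow> 'v) set" where
  "maps V E J Z = {f \<in> verts \<rightarrow>\<^sub>E V. compat E J Z f}"

text \<open>Folding keeps the part of \<open>Z\<close> in \<open>half i j\<close> and adds its
  mirror image. As a preimage under \<open>shift i j\<close>, an iterated fold becomes a preimage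
  under a composition of shifts.\<close>

definition unshift :: "nat \<Rightarrow> nat \<Rightarrow> nat set set \<Rightarrow> nat set set" where
  "unshift i j Z = {z \<in> verts. shift i j z \<in> Z}"

definition unshift_edges :: "nat \<Rightarrow> nat \<Rightarrow> (nat set \<times> nat set) set \<Rightarrow> (nat set \<times> nat set) set" where
  "unshift_edges i j J = {(a, b). (a, b) \<in> incl \<and> (shift i j a, shift i j b) \<in> J}"

text \<open>A closed half: sets fixed by the transposition belong to both \<open>half i j\<close>
  and \<open>half j i\<close>.\<close>

definition half :: "nat \<Rightarrow> nat \<Rightarrow> nat set set" where
  "half i j = {v \<in> verts. j \<in> v \<longrightarrow> i \<in> v}"

lemma finite_maps [simp]: "finite V \<Longrightarrow> finite (maps V E J Z)"
  by (simp add: maps_def finite_PiE)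

lemma depends_on_compat:
  assumes "J \<subseteq> S \<times> S" "Z \<subseteq> S"
  shows "depends_on S (compat E J Z)"
  unfolding depends_on_def
proof (intro allI impI)
  fix f g :: "nat set \<Rightarrow> 'a" assume eq: "\<forall>x\<in>S. f x = g x"
  have "(\<forall>(a, b)\<in>J. (f a, f b) \<in> E) = (\<forall>(a, b)\<in>J. (g a, g b) \<in> E)"
    by (rule ball_cong) (use eq assms in auto)
  moreover have "(\<forall>x\<in>Z. \<forall>y\<in>Z. f x = f y) = (\<forall>x\<in>Z. \<forall>y\<in>Z. g x = g y)"
    by (intro ball_cong refl) (use eq assms in \<open>metis subsetD\<close>)
  ultimately show "compat E J Z f = compat E J Z g"
    by (simp only: compat_def)
qed

text \<open>No edge joins a set containing only \<open>i\<close> to one containing only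
  \<open>j\<close>, since neither includes the other. So the fixed sets separate the two
  sides.\<close>

lemma edge_in_half:
  assumes "(a, b) \<in> incl"
  shows "a \<in> half i j \<and> b \<in> half i j \<or> a \<in> half j i \<and> b \<in> half j i"
  using assms by (auto simp: half_def incl_def verts_def)

lemma shift_half: "v \<in> half i j \<Longrightarrow> shift i j v = v"
  by (auto simp: half_def shift_def)

lemma shift_other_half: "v \<in> half j i \<Longrightarrow> shift i j v = transpose i j ` v"
  by (auto simp: half_def intro!: shift_eq_transpose)

text \<open>A member of \<open>Z\<close> that the transposition fixes carries the common value on \<open>Z\<close> from one half to
  the other; without one the constraint on \<open>Z\<close> would not split into constraints on the halves.\<close>

lemma compat_fold:
  assumes ij: "i \<in> {1..k}" "j \<in> {1..k}" and J: "J \<subseteq> incl" and Z: "Z \<subseteq> verts"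
    and fixed: "Z = {} \<or> (\<exists>z\<in>Z. i \<in> z \<longleftrightarrow> j \<in> z)"
  defines "J' \<equiv> J \<inter> half i j \<times> half i j" and "Z' \<equiv> Z \<inter> half i j" and "t \<equiv> image (transpose i j)"
  shows "compat E J' Z' f \<and> compat E J' Z' (f \<circ> t) \<longleftrightarrow> compat E (unshift_edges i j J) (unshift i j Z) f"
proof
  assume c: "compat E (unshift_edges i j J) (unshift i j Z) f"
  have t: "shift i j (t v) = v" "t v \<in> verts" if "v \<in> half i j" for v
  proof -
    have "t v \<in> half j i"
      using that transpose_layers(3)[OF ij] by (auto simp: half_def t_def)
    then show "shift i j (t v) = v" by (simp add: shift_other_half t_def)
    show "t v \<in> verts" using that transpose_layers(3)[OF ij] by (auto simp: half_def t_def)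
  qed
  have J'1: "(a, b) \<in> unshift_edges i j J" "(t a, t b) \<in> unshift_edges i j J" if "(a, b) \<in> J'" for a b
    using that J transpose_layers(4)[OF ij, of a b]
    by (auto simp: unshift_edges_def J'_def shift_half t) (auto simp: t_def)
  have Z'1: "x \<in> unshift i j Z" "t x \<in> unshift i j Z" if "x \<in> Z'" for x
    using that Z by (auto simp: unshift_def Z'_def shift_half t)
  show "compat E J' Z' f \<and> compat E J' Z' (f \<circ> t)"
    using c J'1 Z'1 by (fastforce simp: compat_def)
next
  assume c: "compat E J' Z' f \<and> compat E J' Z' (f \<circ> t)"
  have tt: "t (t v) = v" for v by (simp add: t_def)
  have to_half: "t v \<in> half i j" if "v \<in> half j i" for v
    using that transpose_layers(3)[OF ij] by (auto simp: half_def t_def)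
  have "(f a, f b) \<in> E" if ab: "(a, b) \<in> unshift_edges i j J" for a b
  proof -
    have ab': "(a, b) \<in> incl" "(shift i j a, shift i j b) \<in> J"
      using ab by (auto simp: unshift_edges_def)
    from edge_in_half[OF ab'(1), of i j] show ?thesis
    proof
      assume "a \<in> half i j \<and> b \<in> half i j"
      then have "(a, b) \<in> J'" using ab' by (auto simp: shift_half J'_def)
      then show ?thesis using c by (auto simp: compat_def)
    next
      assume h: "a \<in> half j i \<and> b \<in> half j i"
      then have "(t a, t b) \<in> J'"
        using ab' to_half by (auto simp: shift_other_half J'_def t_def)
      then have "((f \<circ> t) (t a), (f \<circ> t) (t b)) \<in> E" using c by (auto simp: compat_def)
      then show ?thesis by (simp add: tt)
    qed
  qed
  moreover have "f x = f y" if xy: "x \<in> unshift i j Z" "y \<in> unshift i j Z" for x y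
  proof -
    have "Z \<noteq> {}" using xy by (auto simp: unshift_def)
    then obtain z where z: "z \<in> Z" "i \<in> z \<longleftrightarrow> j \<in> z" using fixed by auto
    then have z': "z \<in> Z'" "t z = z"
      using Z transpose_image_eq[of i z j] by (auto simp: Z'_def half_def t_def)
    have "f x = f z" if x: "x \<in> unshift i j Z" for x
    proof -
      have x': "x \<in> verts" "shift i j x \<in> Z" using x by (auto simp: unshift_def)
      then consider "x \<in> half i j" | "x \<in> half j i" by (auto simp: half_def)
      then show ?thesis
      proof cases
        case 1
        then have "x \<in> Z'" using x' by (simp add: Z'_def shift_half)
        then show ?thesis using c z'(1) unfolding compat_def by blast
      next
        case 2
        then have "t x \<in> Z'" using x' to_half by (auto simp: Z'_def shift_other_half t_def)
        then have "(f \<circ> t) (t x) = (f \<circ> t) z" using c z'(1) unfolding compat_def by blast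
        then show ?thesis by (simp add: tt z')
      qed
    qed
    from this[OF xy(1)] this[OF xy(2)] show ?thesis by simp
  qed
  ultimately show "compat E (unshift_edges i j J) (unshift i j Z) f"
    unfolding compat_def by blast
qed

text \<open>Compatibility splits into a condition \<open>P\<close> on one closed half and a
  condition \<open>Q\<close> on the other: for edges by \<open>edge_in_half\<close>, and for
  \<open>Z\<close> because its fixed member lies in both halves and links their values.
  \<open>card_PiE_fold\<close> then applies, and \<open>compat_fold\<close> identifies the two
  folded conditions.\<close>

lemma maps_fold:
  assumes V: "finite V" and ij: "i \<in> {1..k}" "j \<in> {1..k}" and J: "J \<subseteq> incl" and Z: "Z \<subseteq> verts"
    and fixed: "Z = {} \<or> (\<exists>z\<in>Z. i \<in> z \<longleftrightarrow> j \<in> z)"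
  shows "(card (maps V E J Z))\<^sup>2 \<le>
    card (maps V E (unshift_edges i j J) (unshift i j Z)) * card (maps V E (unshift_edges j i J) (unshift j i Z))"
proof -
  define F where "F = {v \<in> verts. i \<in> v \<longleftrightarrow> j \<in> v}"
  define L where "L = {v \<in> verts. i \<in> v \<and> j \<notin> v}"
  define R where "R = {v \<in> verts. j \<in> v \<and> i \<notin> v}"
  define t :: "nat set \<Rightarrow> nat set" where "t = image (transpose i j)"
  define P where "P = compat E (J \<inter> half i j \<times> half i j) (Z \<inter> half i j)"
  define Q where "Q = compat E (J \<inter> half j i \<times> half j i) (Z \<inter> half j i)"
  have D: "verts = F \<union> L \<union> R" and FL: "F \<union> L = half i j" and FR: "F \<union> R = half j i"
    by (auto simp: F_def L_def R_def half_def)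
  have fin: "finite F" "finite L" "finite R"
    using finite_layers(3) unfolding D by auto
  have disj: "F \<inter> L = {}" "F \<inter> R = {}" "L \<inter> R = {}"
    by (auto simp: F_def L_def R_def)
  have t: "\<And>x. x \<in> L \<Longrightarrow> t x \<in> R" "\<And>x. x \<in> R \<Longrightarrow> t x \<in> L" "\<And>x. x \<in> F \<Longrightarrow> t x = x" "\<And>x. t (t x) = x"
    using transpose_layers(3)[OF ij] by (auto simp: F_def L_def R_def t_def transpose_image_eq)
  have dP: "depends_on (F \<union> L) P" and dQ: "depends_on (F \<union> R) Q"
    unfolding FL FR P_def Q_def by (auto intro!: depends_on_compat)
  have eq: "compat E J Z f \<longleftrightarrow> P f \<and> Q f" for f
  proof
    assume c: "P f \<and> Q f"
    have "(f a, f b) \<in> E" if "(a, b) \<in> J" for a b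
      using edge_in_half[of a b i j] that J c unfolding P_def Q_def compat_def by blast
    moreover have "f x = f y" if xy: "x \<in> Z" "y \<in> Z" for x y
    proof -
      obtain z where z: "z \<in> Z" "i \<in> z \<longleftrightarrow> j \<in> z" using fixed xy by auto
      then have "z \<in> half i j" "z \<in> half j i" using Z by (auto simp: half_def)
      moreover have "w \<in> half i j \<or> w \<in> half j i" if "w \<in> Z" for w
        using that Z by (auto simp: half_def)
      ultimately have "f w = f z" if "w \<in> Z" for w
        using that c z(1) unfolding P_def Q_def compat_def by blast
      from this[OF xy(1)] this[OF xy(2)] show ?thesis by simp
    qed
    ultimately show "compat E J Z f" unfolding compat_def by blast
  qed (unfold P_def Q_def compat_def, blast)
  have P2: "P f \<and> P (f \<circ> t) \<longleftrightarrow> compat E (unshift_edges i j J) (unshift i j Z) f" for f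
    unfolding P_def t_def by (rule compat_fold[OF ij J Z fixed])
  have fixed': "Z = {} \<or> (\<exists>z\<in>Z. j \<in> z \<longleftrightarrow> i \<in> z)" using fixed by auto
  have Q2: "Q f \<and> Q (f \<circ> t) \<longleftrightarrow> compat E (unshift_edges j i J) (unshift j i Z) f" for f
    unfolding Q_def t_def using compat_fold[OF ij(2,1) J Z fixed', of E f]
    by (simp add: transpose_commute)
  show ?thesis
    using card_PiE_fold[OF V fin disj t dP dQ]
    unfolding maps_def D[symmetric] eq P2 Q2 .
qed

section \<open>Sidorenko's inequality\<close>

text \<open>An edge in one closed half is tested by one of the two foldings as itself and by the
  other as its mirror image. Mirroring permutes \<open>incl\<close>, so each test contributes
  \<open>card J\<close> in total.\<close>

lemma card_incl_reflect:
  assumes ij: "i \<in> {1..k}" "j \<in> {1..k}" and J: "J \<subseteq> incl"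
  shows "card (unshift_edges i j J) + card (unshift_edges j i J) = 2 * card J"
proof -
  let ?t = "map_prod (image (transpose i j)) (image (transpose i j))"
  let ?s = "\<lambda>i j. map_prod (shift i j) (shift i j)"
  have card_eq: "card {e \<in> incl. Q e} = (\<Sum>e\<in>incl. of_bool (Q e))" for Q
    by (simp add: sum.inter_filter[symmetric] of_bool_def flip: card_eq_sum)
  have "of_bool (?s i j e \<in> J) + of_bool (?s j i e \<in> J) = of_bool (e \<in> J) + (of_bool (?t e \<in> J) :: nat)"
    if "e \<in> incl" for e
  proof -
    obtain a b where e: "e = (a, b)" by force
    have "a \<in> half i j \<and> b \<in> half i j \<or> a \<in> half j i \<and> b \<in> half j i"
      using edge_in_half that unfolding e .
    then show ?thesis
      unfolding e
      by (elim disjE) (auto simp: shift_half shift_other_half transpose_commute[of j i])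
  qed
  then have "(\<Sum>e\<in>incl. of_bool (?s i j e \<in> J) + of_bool (?s j i e \<in> J)) =
      (\<Sum>e\<in>incl. of_bool (e \<in> J) + (of_bool (?t e \<in> J) :: nat))"
    by (rule sum.cong[OF refl])
  moreover have "(\<Sum>e\<in>incl. of_bool (?t e \<in> J) :: nat) = (\<Sum>e\<in>incl. of_bool (e \<in> J))"
    by (rule sum.reindex_bij_witness[of _ ?t ?t]) (auto dest: transpose_layers(4)[OF ij])
  moreover have "unshift_edges i j J = {e \<in> incl. ?s i j e \<in> J}" for i j
    by (auto simp: unshift_edges_def)
  moreover have "J = {e \<in> incl. e \<in> J}" using J by auto
  ultimately show ?thesis
    using card_eq[of "\<lambda>e. ?s i j e \<in> J"] card_eq[of "\<lambda>e. ?s j i e \<in> J"] card_eq[of "\<lambda>e. e \<in> J"]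
    by (simp add: sum.distrib)
qed

definition unshift_list :: "(nat \<times> nat) list \<Rightarrow> (nat set \<times> nat set) set \<Rightarrow> (nat set \<times> nat set) set" where
  "unshift_list ps J = {(a, b). (a, b) \<in> incl \<and> (shifts ps a, shifts ps b) \<in> J}"

lemma shifts_layers:
  assumes "set ps \<subseteq> {1..k} \<times> {1..k}"
  shows "v \<in> lower \<Longrightarrow> shifts ps v \<in> lower" "v \<in> upper \<Longrightarrow> shifts ps v \<in> upper"
    "(S, T) \<in> incl \<Longrightarrow> (shifts ps S, shifts ps T) \<in> incl"
  using assms by (induction ps) (auto intro: shift_layers)

text \<open>Preimages reverse the order: the head of the list acts last on sets, so it is pulled
  back first.\<close>

lemma unshift_list_Cons:
  assumes "set ps \<subseteq> {1..k} \<times> {1..k}"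
  shows "unshift_list (p # ps) J = unshift_list ps (unshift_edges (fst p) (snd p) J)"
  using shifts_layers(3)[OF assms] by (auto simp: unshift_list_def unshift_edges_def)

lemma unshift_list_induct:
  assumes closed: "\<And>i j J. i \<in> {1..k} \<Longrightarrow> j \<in> {1..k} \<Longrightarrow> Q J \<Longrightarrow> Q (unshift_edges i j J)"
    and base: "\<And>J. Q J \<Longrightarrow> J \<subseteq> incl"
    and ps: "set ps \<subseteq> {1..k} \<times> {1..k}" and J: "Q J"
  shows "Q (unshift_list ps J)"
  using ps J
proof (induction ps arbitrary: J)
  case Nil
  then have "unshift_list [] J = J" using base[of J] by (auto simp: unshift_list_def)
  then show ?case using Nil by simp
next
  case (Cons p ps)
  then have "Q (unshift_list ps (unshift_edges (fst p) (snd p) J))"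
    by (intro Cons.IH closed) auto
  then show ?case using Cons.prems by (simp add: unshift_list_Cons)
qed

text \<open>First everything is gathered on \<open>S0\<close>, which turns \<open>S\<close> into
  \<open>S0\<close> by cardinality and puts \<open>S0\<close> inside \<open>T\<close>. Gathering on
  \<open>T0\<close> afterwards removes only elements outside \<open>T0\<close>, so it leaves
  \<open>S0\<close> alone and turns \<open>T\<close> into \<open>T0\<close>. Thus every edge is
  retracted to one edge, and the preimage of that edge is the whole graph.\<close>

lemma ex_collapse:
  assumes e: "(S0, T0) \<in> incl"
  obtains ps where "set ps \<subseteq> {1..k} \<times> {1..k}"
    "\<And>S T. (S, T) \<in> incl \<Longrightarrow> shifts ps S = S0 \<and> shifts ps T = T0"
proof -
  have S0: "S0 \<subseteq> {1..k}" "card S0 = l" and T0: "T0 \<subseteq> {1..k}" "card T0 = k - l" and ST: "S0 \<subseteq> T0"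
    using e by (auto simp: incl_def lower_def upper_def)
  obtain ps1 where ps1: "set ps1 \<subseteq> S0 \<times> ({1..k} - S0)"
    "\<And>v. v \<subseteq> {1..k} \<Longrightarrow> card S0 \<le> card v \<Longrightarrow> S0 \<subseteq> shifts ps1 v"
    using shifts_collect[of "{1..k}" S0] S0 by auto
  obtain ps2 where ps2: "set ps2 \<subseteq> T0 \<times> ({1..k} - T0)"
    "\<And>v. v \<subseteq> {1..k} \<Longrightarrow> card T0 \<le> card v \<Longrightarrow> T0 \<subseteq> shifts ps2 v"
    using shifts_collect[of "{1..k}" T0] T0 by auto
  have w1: "set ps1 \<subseteq> {1..k} \<times> {1..k}" using ps1(1) S0(1) by blast
  have w2: "set ps2 \<subseteq> {1..k} \<times> {1..k}" using ps2(1) T0(1) by blast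
  have "shifts (ps2 @ ps1) S = S0 \<and> shifts (ps2 @ ps1) T = T0" if "(S, T) \<in> incl" for S T
  proof
    have S: "S \<in> lower" and T: "T \<in> upper" using that by (auto simp: incl_def)
    have "S0 \<subseteq> shifts ps1 S" using ps1(2)[of S] S S0 by (auto simp: lower_def)
    moreover have "shifts ps1 S \<in> lower" by (rule shifts_layers(1)[OF w1 S])
    ultimately have "shifts ps1 S = S0"
      using S0 by (intro card_subset_eq[symmetric]) (auto simp: lower_def intro: finite_subset)
    moreover have "S0 \<inter> snd ` set ps2 = {}" using ps2(1) ST by auto
    ultimately show "shifts (ps2 @ ps1) S = S0" by (simp add: shifts_append shifts_id)
    have T1: "shifts ps1 T \<in> upper" by (rule shifts_layers(2)[OF w1 T])
    then have "T0 \<subseteq> shifts ps2 (shifts ps1 T)" using ps2(2) T0 by (auto simp: upper_def)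
    moreover have "shifts ps2 (shifts ps1 T) \<in> upper" by (rule shifts_layers(2)[OF w2 T1])
    ultimately have "shifts ps2 (shifts ps1 T) = T0"
      using T0 by (intro card_subset_eq[symmetric]) (auto simp: upper_def intro: finite_subset)
    then show "shifts (ps2 @ ps1) T = T0" by (simp add: shifts_append)
  qed
  then show thesis using that[of "ps2 @ ps1"] w1 w2 by auto
qed

lemma card_maps_single:
  assumes V: "finite V" and E: "E \<subseteq> V \<times> V" and e: "(a, b) \<in> incl"
  shows "card (maps V E {(a, b)} {}) = card E * card V ^ (card verts - 2)"
proof -
  have ab: "a \<noteq> b" "a \<in> verts" "b \<in> verts"
    using e layers_disjoint by (auto simp: incl_def verts_def)
  let ?R = "verts - {a, b}"
  have 1: "card {h \<in> {a, b} \<rightarrow>\<^sub>E V. compat E {(a, b)} {} h} = card E"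
    using card_PiE_pair[OF E ab(1)] by (simp add: compat_def)
  have 2: "card (?R \<rightarrow>\<^sub>E V) = card V ^ (card verts - 2)"
    using ab by (simp add: card_PiE card_Diff_subset numeral_2_eq_2)
  have "card {f \<in> ({} \<union> {a, b} \<union> ?R) \<rightarrow>\<^sub>E V. compat E {(a, b)} {} f \<and> True} =
    (\<Sum>g \<in> {} \<rightarrow>\<^sub>E V. card {h \<in> {a, b} \<rightarrow>\<^sub>E V. compat E {(a, b)} {} (join {} g h)} * card {h \<in> ?R \<rightarrow>\<^sub>E V. True})"
  proof (rule card_PiE_split)
    show "depends_on ({} \<union> {a, b}) (compat E {(a, b)} {})"
      by (rule depends_on_compat) auto
  qed (use V in \<open>auto simp: depends_on_def\<close>)
  moreover have "{} \<union> {a, b} \<union> ?R = verts" using ab by auto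
  moreover have "join {} g h = h" for g h :: "nat set \<Rightarrow> 'a" by (simp add: join_def fun_eq_iff)
  ultimately show ?thesis
    by (simp add: maps_def 1 2)
qed

text \<open>Let \<open>x\<close> be the edge density of the host and \<open>h J\<close> the density of maps preserving \<open>J\<close>.  Both foldings
  of a maximizer of \<open>h J / x ^ card J\<close> are maximizers again, and folding a nonempty set of edges
  eventually yields all of \<open>H\<close>.\<close>

lemma sidorenko:
  assumes V: "finite V" "V \<noteq> {}" and E: "E \<subseteq> V \<times> V"
  shows "(card E / (card V)\<^sup>2) ^ card incl \<le> card (maps V E incl {}) / real (card V) ^ card verts"
proof (rule ccontr)
  assume contra: "\<not> ?thesis"
  define n where "n = real (card V)"
  have n: "n > 0" using V by (simp add: n_def card_gt_0_iff)
  define h where "h J = card (maps V E J {}) / n ^ card verts" for J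
  define x where "x = card E / n\<^sup>2"
  have h_incl: "h incl < x ^ card incl" using contra by (simp add: h_def x_def n_def)
  define S0 T0 where "S0 = {1..l}" and "T0 = {1..k - l}"
  have e0: "(S0, T0) \<in> incl"
    using l_less by (auto simp: S0_def T0_def incl_def lower_def upper_def)
  then have incl_pos: "card incl > 0" by (auto simp: card_gt_0_iff)
  \<comment> \<open>A failure of the inequality forces positive density, so the division by powers
    of \<open>x\<close> below is legitimate.\<close>
  have "h incl \<ge> 0" using n by (simp add: h_def)
  then have "x ^ card incl > 0" using h_incl by linarith
  moreover have "x \<ge> 0" by (simp add: x_def)
  ultimately have x: "x > 0" using incl_pos by (cases "x = 0") (auto simp: zero_power)
  have verts2: "card verts \<ge> 2"
  proof -
    have "card {S0, T0} \<le> card verts"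
      using e0 by (intro card_mono) (auto simp: incl_def verts_def)
    moreover have "S0 \<noteq> T0" using e0 layers_disjoint by (auto simp: incl_def)
    ultimately show ?thesis by simp
  qed
  have h_single: "h {(S0, T0)} = x"
  proof -
    have "n ^ card verts = n ^ (card verts - 2) * n\<^sup>2"
      using verts2 power_add[of n "card verts - 2" 2] by (simp only: le_add_diff_inverse2)
    then show ?thesis
      using n by (simp add: h_def x_def card_maps_single[OF V(1) E e0] n_def[symmetric])
  qed
  have h_empty: "h {} = 1"
    using n V by (simp add: h_def maps_def compat_def card_PiE n_def)
  define q where "q J = h J / x ^ card J" for J
  have q0: "q J \<ge> 0" for J using n x by (simp add: q_def h_def)
  have q_fold: "(q J)\<^sup>2 \<le> q (unshift_edges i j J) * q (unshift_edges j i J)"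
    if "J \<subseteq> incl" "i \<in> {1..k}" "j \<in> {1..k}" for J i j
  proof -
    let ?N = "\<lambda>J. real (card (maps V E J {}))"
    have "(card (maps V E J {}))\<^sup>2 \<le>
        card (maps V E (unshift_edges i j J) {}) * card (maps V E (unshift_edges j i J) {})"
      using maps_fold[OF V(1) that(2,3,1), of "{}" E] by (simp add: unshift_def)
    then have "(?N J)\<^sup>2 \<le> ?N (unshift_edges i j J) * ?N (unshift_edges j i J)"
      by (metis of_nat_le_iff of_nat_mult of_nat_power)
    then have "(?N J)\<^sup>2 / (n ^ card verts * n ^ card verts) / x ^ (2 * card J) \<le>
       ?N (unshift_edges i j J) * ?N (unshift_edges j i J) / (n ^ card verts * n ^ card verts) / x ^ (2 * card J)"
      using n x by (intro divide_right_mono) auto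
    moreover have "(q J)\<^sup>2 = (?N J)\<^sup>2 / (n ^ card verts * n ^ card verts) / x ^ (2 * card J)"
      by (simp add: q_def h_def power2_eq_square power_add mult_2)
    \<comment> \<open>The two foldings of \<open>J\<close> have \<open>2 * card J\<close> edges
      together, so the normalization in \<open>q\<close> is compatible with folding.\<close>
    moreover have "x ^ (2 * card J) = x ^ card (unshift_edges i j J) * x ^ card (unshift_edges j i J)"
      by (simp flip: power_add add: card_incl_reflect[OF that(2,3,1)])
    then have "q (unshift_edges i j J) * q (unshift_edges j i J) =
       ?N (unshift_edges i j J) * ?N (unshift_edges j i J) / (n ^ card verts * n ^ card verts) / x ^ (2 * card J)"
      by (simp add: q_def h_def)
    ultimately show ?thesis
      by simp
  qed
  have finJ: "finite (q ` Pow incl)" "q ` Pow incl \<noteq> {}" by auto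
  define M where "M = Max (q ` Pow incl)"
  have M: "q J \<le> M" if "J \<subseteq> incl" for J
    using finJ that by (auto simp: M_def intro!: Max_ge)
  have q1: "q {} = 1" "q {(S0, T0)} = 1" using x by (auto simp: q_def h_empty h_single)
  then have M1: "M \<ge> 1" using M[of "{}"] by simp
  have "M \<in> q ` Pow incl" unfolding M_def by (rule Max_in[OF finJ])
  \<comment> \<open>The maximizer must be nonempty. The empty set has quotient 1, so it is excluded
    if \<open>M > 1\<close>; if \<open>M = 1\<close>, a single edge is a maximizer as well.\<close>
  then obtain J where J: "J \<subseteq> incl" "J \<noteq> {}" "q J = M"
    using q1 e0 by (cases "M = 1") (auto intro: that[of "{(S0, T0)}"])
  define Q where "Q J \<longleftrightarrow> J \<subseteq> incl \<and> q J = M" for J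
  have closed: "Q (unshift_edges i j J)" if ij: "i \<in> {1..k}" "j \<in> {1..k}" and Q: "Q J" for i j J
  proof -
    have sub: "unshift_edges i j J \<subseteq> incl" for i j by (auto simp: unshift_edges_def)
    have "M * M \<le> q (unshift_edges i j J) * q (unshift_edges j i J)"
      using q_fold[of J i j] Q ij by (simp add: Q_def power2_eq_square)
    also have "\<dots> \<le> q (unshift_edges i j J) * M"
      by (intro mult_left_mono M sub q0)
    finally have "M \<le> q (unshift_edges i j J)" using M1 by simp
    then show ?thesis using M[OF sub, of i j] sub by (auto simp: Q_def)
  qed
  obtain a b where ab: "(a, b) \<in> J" using J(2) by auto
  obtain ps where ps: "set ps \<subseteq> {1..k} \<times> {1..k}"
    "\<And>S T. (S, T) \<in> incl \<Longrightarrow> shifts ps S = a \<and> shifts ps T = b"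
    using ex_collapse[of a b] ab J(1) by blast
  have "Q (unshift_list ps J)"
    by (rule unshift_list_induct[where Q = Q, OF closed _ ps(1)]) (use J in \<open>auto simp: Q_def\<close>)
  moreover have "unshift_list ps J = incl" using ps(2) ab by (auto simp: unshift_list_def)
  ultimately have "q incl = M" by (simp add: Q_def)
  then have "h incl \<ge> x ^ card incl"
    using M1 x by (simp add: q_def field_simps)
  then show False using h_incl by simp
qed

section \<open>Concentrated homomorphisms\<close>

text \<open>The fraction of homomorphisms that are constant on \<open>Z\<close>. Without any
  homomorphism it is 0, by the convention for division by zero.\<close>

definition ratio :: "'v set \<Rightarrow> ('v \<times> 'v) set \<Rightarrow> nat set set \<Rightarrow> real" where
  "ratio V E Z = card (maps V E incl Z) / card (maps V E incl {})"

lemma maps_mono: "finite V \<Longrightarrow> Z' \<subseteq> Z \<Longrightarrow> card (maps V E J Z) \<le> card (maps V E J Z')"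
  by (rule card_mono, simp, unfold maps_def compat_def) blast

lemma ratio_nonneg [simp]: "0 \<le> ratio V E Z"
  by (simp add: ratio_def)

lemma ratio_mono: "finite V \<Longrightarrow> Z' \<subseteq> Z \<Longrightarrow> ratio V E Z \<le> ratio V E Z'"
  using maps_mono[of V Z' Z E incl] by (auto simp: ratio_def intro!: divide_right_mono)

lemma ratio_le_1: "finite V \<Longrightarrow> ratio V E Z \<le> 1"
  using maps_mono[of V "{}" Z E incl] by (auto simp: ratio_def divide_le_eq_1)

lemma unshift_edges_incl:
  assumes "i \<in> {1..k}" "j \<in> {1..k}"
  shows "unshift_edges i j incl = incl"
  using shift_layers(4)[OF assms] by (auto simp: unshift_edges_def)

text \<open>Folding preserves the full edge set, and the second folding is bounded trivially by the
  number of all homomorphisms.\<close>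

lemma ratio_unshift:
  assumes V: "finite V" and ij: "i \<in> {1..k}" "j \<in> {1..k}" and Z: "Z \<subseteq> verts"
    and z: "z \<in> Z" "i \<in> z \<longleftrightarrow> j \<in> z"
  shows "(ratio V E Z)\<^sup>2 \<le> ratio V E (unshift i j Z)"
proof -
  let ?N = "\<lambda>Z. real (card (maps V E incl Z))"
  have "(card (maps V E incl Z))\<^sup>2 \<le> card (maps V E incl (unshift i j Z)) * card (maps V E incl (unshift j i Z))"
    using maps_fold[OF V ij subset_refl Z, of E] z
    unfolding unshift_edges_incl[OF ij] unshift_edges_incl[OF ij(2,1)] by blast
  also have "\<dots> \<le> card (maps V E incl (unshift i j Z)) * card (maps V E incl {})"
    using V by (intro mult_left_mono maps_mono) auto
  finally have "(?N Z)\<^sup>2 \<le> ?N (unshift i j Z) * ?N {}"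
    by (metis of_nat_le_iff of_nat_mult of_nat_power)
  then have "(?N Z)\<^sup>2 / (?N {})\<^sup>2 \<le> ?N (unshift i j Z) * ?N {} / (?N {})\<^sup>2"
    by (intro divide_right_mono) auto
  then show ?thesis
    by (simp add: ratio_def power2_eq_square split: if_splits)
qed

text \<open>The exponent must not depend on the host.\<close>

definition forces :: "nat set set \<Rightarrow> nat set set \<Rightarrow> bool" where
  "forces Z Z' \<longleftrightarrow> (\<exists>q. \<forall>V (E :: (nat \<times> nat) set). finite V \<longrightarrow> ratio V E Z ^ q \<le> ratio V E Z')"

lemma forces_subset: "Z' \<subseteq> Z \<Longrightarrow> forces Z Z'"
  unfolding forces_def by (rule exI[of _ 1]) (auto intro: ratio_mono)

lemma forces_trans [trans]:
  assumes "forces Z Z'" "forces Z' Z''"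
  shows "forces Z Z''"
proof -
  obtain p where p: "ratio V E Z ^ p \<le> ratio V E Z'" if "finite V" for V and E :: "(nat \<times> nat) set"
    using assms(1) by (auto simp: forces_def)
  obtain q where q: "ratio V E Z' ^ q \<le> ratio V E Z''" if "finite V" for V and E :: "(nat \<times> nat) set"
    using assms(2) by (auto simp: forces_def)
  have "ratio V E Z ^ (p * q) \<le> ratio V E Z''" if "finite V" for V and E :: "(nat \<times> nat) set"
    using power_mono[OF p[OF that], of E q] q[OF that, of E] by (simp add: power_mult)
  then show ?thesis unfolding forces_def by blast
qed

lemma forces_unshift:
  assumes "i \<in> {1..k}" "j \<in> {1..k}" "Z \<subseteq> verts" "z \<in> Z" "i \<in> z \<longleftrightarrow> j \<in> z"
  shows "forces Z (unshift i j Z)"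
  unfolding forces_def using ratio_unshift[OF _ assms] by blast

section \<open>Spreading a coincidence over the lower layer\<close>

definition star :: "nat set \<Rightarrow> nat set set" where
  "star u = {v \<in> lower. u \<subseteq> v}"

lemma insert_lower:
  assumes "u \<subseteq> {1..k}" "card u = l - 1" "c \<in> {1..k}" "c \<notin> u"
  shows "insert c u \<in> star u"
proof -
  have "finite u" using assms(1) by (rule finite_subset) simp
  then show ?thesis using assms l_pos by (auto simp: lower_def star_def)
qed

lemma unshift_lower:
  assumes ij: "i \<in> {1..k}" "j \<in> {1..k}" and Z: "Z \<subseteq> lower"
  shows "unshift i j Z = {z \<in> lower. shift i j z \<in> Z}"
proof -
  have "z \<in> lower" if "z \<in> verts" "shift i j z \<in> Z" for z
    using that Z shift_layers(2)[OF ij, of z] layers_disjoint by (auto simp: verts_def)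
  then show ?thesis by (auto simp: unshift_def verts_def)
qed

text \<open>Each fold is permitted because \<open>insert c u\<close>, a member of the star, contains
  both exchanged elements \<open>s\<close> and \<open>c\<close>. The star survives the fold, since
  its members already contain \<open>s\<close> and are not moved.\<close>

lemma forces_shifts:
  assumes u: "u \<subseteq> {1..k}" "card u = l - 1" and ps: "set ps \<subseteq> u \<times> ({1..k} - u)"
    and Z: "star u \<subseteq> Z" "Z \<subseteq> lower"
  shows "forces Z {v \<in> lower. shifts ps v \<in> Z}"
  using ps Z
proof (induction ps arbitrary: Z)
  case Nil
  then show ?case by (intro forces_subset) auto
next
  case (Cons p ps)
  obtain s c where p: "p = (s, c)" by force
  have sc: "s \<in> u" "s \<in> {1..k}" "c \<in> {1..k}" "c \<notin> u" using Cons.prems(1) u by (auto simp: p)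
  have un: "unshift s c Z = {z \<in> lower. shift s c z \<in> Z}"
    by (rule unshift_lower[OF sc(2,3) Cons.prems(3)])
  have "forces Z (unshift s c Z)"
  proof (rule forces_unshift[OF sc(2,3)])
    show "insert c u \<in> Z" using insert_lower[OF u sc(3,4)] Cons.prems(2) by auto
    show "Z \<subseteq> verts" using Cons.prems(3) by (auto simp: verts_def)
  qed (use sc in auto)
  also have "forces (unshift s c Z) {v \<in> lower. shifts ps v \<in> unshift s c Z}"
  proof (rule Cons.IH)
    show "star u \<subseteq> unshift s c Z"
      using Cons.prems(2) sc(1) by (auto simp: un star_def shift_def)
  qed (use Cons.prems(1) in \<open>auto simp: un\<close>)
  also have "{v \<in> lower. shifts ps v \<in> unshift s c Z} = {v \<in> lower. shifts (p # ps) v \<in> Z}"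
  proof -
    have "set ps \<subseteq> {1..k} \<times> {1..k}" using Cons.prems(1) u by auto
    then show ?thesis using shifts_layers(1)[of ps] by (auto simp: un p)
  qed
  finally show ?case .
qed

text \<open>By \<open>shifts_collect\<close>, a fixed sequence of shifts moves every
  \<open>l\<close>-set into the star, so the preimage of the star is the whole layer.\<close>

lemma forces_star:
  assumes u: "u \<subseteq> {1..k}" "card u = l - 1"
  shows "forces (star u) lower"
proof -
  obtain ps where ps: "set ps \<subseteq> u \<times> ({1..k} - u)"
    "\<And>v. v \<subseteq> {1..k} \<Longrightarrow> card u \<le> card v \<Longrightarrow> u \<subseteq> shifts ps v"
    using shifts_collect[of "{1..k}" u] u by auto
  have ps': "set ps \<subseteq> {1..k} \<times> {1..k}" using ps(1) u by auto
  have "forces (star u) {v \<in> lower. shifts ps v \<in> star u}"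
    by (rule forces_shifts[OF u ps(1)]) (auto simp: star_def)
  moreover have "shifts ps v \<in> star u" if "v \<in> lower" for v
    using ps(2)[of v] that u shifts_layers(1)[OF ps' that] by (auto simp: star_def lower_def)
  then have "{v \<in> lower. shifts ps v \<in> star u} = lower" by auto
  ultimately show ?thesis by simp
qed

lemma shift_insert: "a \<notin> u \<Longrightarrow> c \<notin> u \<Longrightarrow> shift a c (insert c u) = insert a u"
  by (cases "a = c") (auto simp: shift_def)

text \<open>The remaining members \<open>insert c u\<close> are added one by one by folding along
  \<open>a\<close>, \<open>c\<close>. The set \<open>insert b u\<close> contains neither element and
  so permits the fold; \<open>insert c u\<close> is shifted to \<open>insert a u\<close>, and the
  members found so far do not contain \<open>c\<close> and stay.\<close>

lemma forces_adjacent: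
  assumes u: "u \<subseteq> {1..k}" "card u = l - 1"
    and ab: "a \<in> {1..k}" "b \<in> {1..k}" "a \<notin> u" "b \<notin> u" "a \<noteq> b"
  shows "forces {insert a u, insert b u} (star u)"
proof -
  have "forces {insert a u, insert b u} ({insert a u, insert b u} \<union> (\<lambda>c. insert c u) ` C)"
    if "finite C" "C \<subseteq> {1..k} - u - {a, b}" for C
    using that
  proof (induction C)
    case empty
    show ?case by (intro forces_subset) auto
  next
    case (insert c C)
    let ?Z = "{insert a u, insert b u} \<union> (\<lambda>c. insert c u) ` C"
    have c: "c \<in> {1..k}" "c \<notin> u" "c \<noteq> a" "c \<noteq> b" "c \<notin> C" using insert by auto
    have Z: "?Z \<subseteq> lower"
      using insert_lower[OF u] insert.prems ab by (auto simp: star_def)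
    have "forces {insert a u, insert b u} ?Z" using insert by simp
    also have "forces ?Z (unshift a c ?Z)"
      by (rule forces_unshift[where z = "insert b u"]) (use Z ab c in \<open>auto simp: verts_def\<close>)
    also have "forces (unshift a c ?Z) ({insert a u, insert b u} \<union> (\<lambda>c. insert c u) ` insert c C)"
    proof (rule forces_subset)
      have un: "unshift a c ?Z = {z \<in> lower. shift a c z \<in> ?Z}"
        by (rule unshift_lower[OF ab(1) c(1) Z])
      have "shift a c v = v" if "v \<in> ?Z" for v
        using that c insert.prems by (auto simp: shift_def)
      then have "?Z \<subseteq> unshift a c ?Z" using Z unfolding un by force
      moreover have "shift a c (insert c u) \<in> ?Z"
        using shift_insert[of a u c] ab c by blast
      then have "insert c u \<in> unshift a c ?Z"
        using insert_lower[OF u c(1,2)] unfolding un by (simp add: star_def)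
      ultimately show "{insert a u, insert b u} \<union> (\<lambda>c. insert c u) ` insert c C \<subseteq> unshift a c ?Z"
        by blast
    qed
    finally show ?case .
  qed
  from this[of "{1..k} - u - {a, b}"]
  have "forces {insert a u, insert b u}
      ({insert a u, insert b u} \<union> (\<lambda>c. insert c u) ` ({1..k} - u - {a, b}))"
    by simp
  also have "forces \<dots> (star u)"
  proof (intro forces_subset subsetI)
    fix v assume v: "v \<in> star u"
    then have uv: "u \<subseteq> v" "v \<subseteq> {1..k}" "card v = l" by (auto simp: star_def lower_def)
    have "finite u" using u(1) by (rule finite_subset) simp
    then have "card (v - u) = 1"
      using u uv l_pos by (simp add: card_Diff_subset)
    then obtain c where c: "v - u = {c}" by (auto simp: card_1_singleton_iff)
    with uv have "v = insert c u" by auto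
    moreover have "c \<in> {1..k} - u" using c uv by auto
    ultimately show "v \<in> {insert a u, insert b u} \<union> (\<lambda>c. insert c u) ` ({1..k} - u - {a, b})"
      by auto
  qed
  finally show ?thesis .
qed

text \<open>Since \<open>2 * l < k\<close>, some \<open>z\<close> avoids both sets. With
  \<open>a\<close> in \<open>x\<close> but not in \<open>y\<close>, the set \<open>y\<close> is
  fixed by exchanging \<open>a\<close> and \<open>z\<close> and permits a fold to an adjacent pair,
  which spreads to a star and then to the layer.\<close>

lemma forces_pair_lower:
  assumes x: "x \<in> lower" and y: "y \<in> lower" and "x \<noteq> y"
  shows "forces {x, y} lower"
proof -
  have x': "x \<subseteq> {1..k}" "card x = l" "finite x" and y': "y \<subseteq> {1..k}" "card y = l" "finite y"
    using x y finite_subset by (auto simp: lower_def)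
  have "\<not> x \<subseteq> y" using card_subset_eq[of y x] x' y' \<open>x \<noteq> y\<close> by auto
  then obtain a where a: "a \<in> x" "a \<notin> y" by auto
  have "card (x \<union> y) < card {1..k}"
    using card_Un_le[of x y] x' y' l_less by simp
  then have "\<not> {1..k} \<subseteq> x \<union> y"
    using x' y' card_mono[of "x \<union> y" "{1..k}"] by auto
  then obtain z where z: "z \<in> {1..k}" "z \<notin> x" "z \<notin> y" by blast
  \<comment> \<open>The fold along \<open>a\<close>, \<open>z\<close> reaches the pair \<open>x\<close>, \<open>x - {a} \<union> {z}\<close> at distance one.\<close>
  define u where "u = x - {a}"
  have u: "u \<subseteq> {1..k}" "card u = l - 1" "a \<notin> u" "z \<notin> u" "x = insert a u" "a \<in> {1..k}" "a \<noteq> z"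
    using x' a z by (auto simp: u_def)
  have Z: "{x, y} \<subseteq> lower" using x y by auto
  have "forces {x, y} (unshift a z {x, y})"
    by (rule forces_unshift[where z = y]) (use a z u Z in \<open>auto simp: verts_def\<close>)
  also have "forces (unshift a z {x, y}) {insert a u, insert z u}"
  proof (rule forces_subset)
    have "shift a z (insert z u) = x" using u by (simp add: shift_insert)
    moreover have "shift a z x = x" using a by (simp add: shift_def)
    moreover have "insert z u \<in> lower" using insert_lower[OF u(1,2) z(1) u(4)] by (simp add: star_def)
    ultimately show "{insert a u, insert z u} \<subseteq> unshift a z {x, y}"
      unfolding unshift_lower[OF u(6) z(1) Z] using x u(5) by simp
  qed
  also have "forces {insert a u, insert z u} (star u)"
    using u z by (intro forces_adjacent) auto
  also have "forces (star u) lower"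
    using u by (intro forces_star)
  finally show ?thesis .
qed

section \<open>Complementation and the upper layer\<close>

definition compl :: "nat set \<Rightarrow> nat set" where
  "compl v = {1..k} - v"

lemma compl_layers:
  "v \<in> lower \<Longrightarrow> compl v \<in> upper" "v \<in> upper \<Longrightarrow> compl v \<in> lower" "v \<in> verts \<Longrightarrow> compl v \<in> verts"
  "(S, T) \<in> incl \<Longrightarrow> (compl T, compl S) \<in> incl"
proof -
  show 1: "v \<in> lower \<Longrightarrow> compl v \<in> upper" "v \<in> upper \<Longrightarrow> compl v \<in> lower" for v
    using l_less by (auto simp: lower_def upper_def compl_def card_Diff_subset finite_subset)
  then show "v \<in> verts \<Longrightarrow> compl v \<in> verts" by (auto simp: verts_def)
  show "(S, T) \<in> incl \<Longrightarrow> (compl T, compl S) \<in> incl"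
    using 1(1)[of S] 1(2)[of T] by (auto simp: incl_def) (auto simp: compl_def)
qed

lemma compl_compl: "v \<in> verts \<Longrightarrow> compl (compl v) = v"
  by (auto simp: compl_def verts_def lower_def upper_def)

lemma compl_image_upper: "compl ` upper = lower"
proof
  show "compl ` upper \<subseteq> lower" using compl_layers(2) by auto
  show "lower \<subseteq> compl ` upper"
  proof
    fix v assume "v \<in> lower"
    then have "v = compl (compl v)" "compl v \<in> upper"
      using compl_compl compl_layers(1) by (auto simp: verts_def)
    then show "v \<in> compl ` upper" by (rule image_eqI)
  qed
qed

text \<open>Complementation is an involution that reverses inclusion. Composing with it gives a
  bijection onto the homomorphisms into the reversed host and exchanges the roles of the
  layers.\<close>

lemma card_maps_compl:
  assumes Z: "Z \<subseteq> verts"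
  shows "card (maps V E incl Z) = card (maps V (E\<inverse>) incl (compl ` Z))"
proof -
  let ?g = "\<lambda>f. restrict (f \<circ> compl) verts"
  have edge: "a \<in> verts" "b \<in> verts" if "(a, b) \<in> incl" for a b
    using that by (auto simp: incl_def verts_def)
  \<comment> \<open>Stated for every host and every \<open>Z\<close>, so that it also serves for the
    inverse map.\<close>
  have fwd: "?g f \<in> maps V (E\<inverse>) incl (compl ` Z)" if "f \<in> maps V E incl Z" "Z \<subseteq> verts"
    for f :: "nat set \<Rightarrow> 'a" and E Z V
  proof -
    have "(?g f a, ?g f b) \<in> E\<inverse>" if "(a, b) \<in> incl" for a b
      using edge[OF that] compl_layers(4)[OF that] \<open>f \<in> maps V E incl Z\<close>
      by (auto simp: maps_def compat_def)
    then have "\<forall>(a, b)\<in>incl. (?g f a, ?g f b) \<in> E\<inverse>" by blast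
    moreover have eq: "?g f (compl x) = f x" if "x \<in> Z" for x
      using that \<open>Z \<subseteq> verts\<close> compl_layers(3)[of x] compl_compl[of x] by auto
    have const: "f x = f y" if "x \<in> Z" "y \<in> Z" for x y
      using that \<open>f \<in> maps V E incl Z\<close> unfolding maps_def compat_def by blast
    have "\<forall>x\<in>compl ` Z. \<forall>y\<in>compl ` Z. ?g f x = ?g f y"
    proof (intro ballI, elim imageE)
      fix x y x' y' assume "x = compl x'" "x' \<in> Z" "y = compl y'" "y' \<in> Z"
      then show "?g f x = ?g f y" using eq[of x'] eq[of y'] const[of x' y'] by simp
    qed
    moreover have "?g f \<in> verts \<rightarrow>\<^sub>E V"
      using \<open>f \<in> maps V E incl Z\<close> compl_layers(3) by (auto simp: maps_def)
    ultimately show ?thesis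
      unfolding maps_def compat_def by blast
  qed
  have inv: "?g (?g f) = f" if "f \<in> verts \<rightarrow>\<^sub>E V" for f and V :: "'a set"
    using that compl_layers(3) compl_compl by (auto simp: fun_eq_iff PiE_def extensional_def)
  have ZZ: "compl ` compl ` Z = Z"
    using Z compl_compl by (force simp: image_image)
  have Z': "compl ` Z \<subseteq> verts" using Z compl_layers(3) by auto
  have inv': "?g (?g f) = f" if "f \<in> maps V E Z Z'" for f and E Z Z' and V :: "'a set"
    using that inv[of f V] by (simp add: maps_def)
  have "bij_betw ?g (maps V E incl Z) (maps V (E\<inverse>) incl (compl ` Z))"
  proof (rule bij_betw_byWitness[where f' = ?g])
    show "?g ` maps V E incl Z \<subseteq> maps V (E\<inverse>) incl (compl ` Z)"
      using fwd[OF _ Z] by blast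
    show "?g ` maps V (E\<inverse>) incl (compl ` Z) \<subseteq> maps V E incl Z"
      using fwd[OF _ Z', of _ V "E\<inverse>"] unfolding ZZ converse_converse by blast
  qed (use inv' in blast)+
  then show ?thesis by (rule bij_betw_same_card)
qed

lemma ratio_compl: "Z \<subseteq> verts \<Longrightarrow> ratio V E Z = ratio V (E\<inverse>) (compl ` Z)"
  using card_maps_compl[of Z V E] card_maps_compl[of "{}" V E] by (simp add: ratio_def)

text \<open>The exponent for the complementary pair is valid for all hosts, in particular for the
  reversed one.\<close>

lemma forces_pair_upper:
  assumes x: "x \<in> upper" and y: "y \<in> upper" and "x \<noteq> y"
  shows "forces {x, y} upper"
proof -
  have v: "x \<in> verts" "y \<in> verts" using x y by (auto simp: verts_def)
  then have "compl x \<noteq> compl y" using compl_compl \<open>x \<noteq> y\<close> by metis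
  then have "forces {compl x, compl y} lower"
    using x y compl_layers(2) by (intro forces_pair_lower)
  then obtain q where q: "ratio V E {compl x, compl y} ^ q \<le> ratio V E lower"
    if "finite V" for V and E :: "(nat \<times> nat) set"
    by (auto simp: forces_def)
  have "ratio V E {x, y} ^ q \<le> ratio V E upper" if "finite V" for V and E :: "(nat \<times> nat) set"
    using q[OF that, of "E\<inverse>"] v ratio_compl[of "{x, y}" V E] ratio_compl[of upper V E]
    by (simp add: compl_image_upper) (simp add: verts_def)
  then show ?thesis by (auto simp: forces_def)
qed

lemma lower_has_edge: "S \<in> lower \<Longrightarrow> \<exists>T. (S, T) \<in> incl"
proof -
  assume S: "S \<in> lower"
  then have "card S \<le> k - l" "k - l \<le> card {1..k}" "S \<subseteq> {1..k}"
    using l_less by (auto simp: lower_def)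
  then obtain T where "S \<subseteq> T" "T \<subseteq> {1..k}" "card T = k - l"
    using exists_subset_between[of S "k - l" "{1..k}"] by auto
  then show ?thesis using S by (auto simp: incl_def upper_def)
qed

lemma upper_has_edge: "T \<in> upper \<Longrightarrow> \<exists>S. (S, T) \<in> incl"
proof -
  assume "T \<in> upper"
  then have T: "T \<subseteq> {1..k}" "card T = k - l" "T \<in> upper" by (auto simp: upper_def)
  then have "l \<le> card T" using l_less by simp
  then obtain S where "S \<subseteq> T" "card S = l"
    by (rule obtain_subset_with_card_n)
  then show ?thesis using T by (auto simp: incl_def lower_def)
qed

text \<open>Layers go to disjoint sets, so a non-injective homomorphism identifies two vertices of
  the same layer. By a union bound over such pairs, some pair is identified by a constant fraction
  of the homomorphisms, and this pair forces its layer.\<close>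

lemma concentrated_or_injective:
  "\<exists>\<delta>>0. \<forall>V (E :: (nat \<times> nat) set) X Y. finite V \<and> E \<subseteq> X \<times> Y \<and> X \<inter> Y = {} \<and>
     maps V E incl {} \<noteq> {} \<and> (\<forall>f\<in>maps V E incl {}. \<not> inj_on f verts) \<longrightarrow>
     \<delta> \<le> max (ratio V E lower) (ratio V E upper)"
proof -
  define PP where "PP = {(x, y). x \<noteq> y \<and> (x \<in> lower \<and> y \<in> lower \<or> x \<in> upper \<and> y \<in> upper)}"
  have "PP \<subseteq> verts \<times> verts" by (auto simp: PP_def verts_def)
  then have finPP: "finite PP" by (rule finite_subset) auto
  have "\<exists>q. \<forall>V (E :: (nat \<times> nat) set). finite V \<longrightarrow>
      ratio V E {fst p, snd p} ^ q \<le> max (ratio V E lower) (ratio V E upper)" if "p \<in> PP" for p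
  proof -
    have "forces {fst p, snd p} lower \<or> forces {fst p, snd p} upper"
      using that forces_pair_lower[of "fst p" "snd p"] forces_pair_upper[of "fst p" "snd p"]
      unfolding PP_def by fastforce
    then show ?thesis unfolding forces_def le_max_iff_disj by blast
  qed
  then obtain q where q: "ratio V E {fst p, snd p} ^ q p \<le> max (ratio V E lower) (ratio V E upper)"
    if "p \<in> PP" "finite V" for p V and E :: "(nat \<times> nat) set"
    by metis
  \<comment> \<open>\<open>Q\<close> dominates every \<open>q p\<close>, and ratios are at most 1,
    so one exponent serves all pairs. The extra 1 in \<open>N\<close> makes the union bound
    strict.\<close>
  define Q where "Q = (\<Sum>p\<in>PP. q p)"
  define N where "N = real (card PP) + 1"
  have bound: "(1 / N) ^ Q \<le> max (ratio V E lower) (ratio V E upper)"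
    if V: "finite V" and E: "E \<subseteq> X \<times> Y" "X \<inter> Y = {}" and ne: "maps V E incl {} \<noteq> {}"
      and ninj: "\<forall>f\<in>maps V E incl {}. \<not> inj_on f verts"
    for V X Y and E :: "(nat \<times> nat) set"
  proof (cases "\<exists>p\<in>PP. 1 / N \<le> ratio V E {fst p, snd p}")
    case True
    then obtain p where p: "p \<in> PP" "1 / N \<le> ratio V E {fst p, snd p}" by blast
    have "q p \<le> Q" unfolding Q_def using finPP p(1) by (intro member_le_sum) auto
    have "(1 / N) ^ Q \<le> ratio V E {fst p, snd p} ^ Q"
      using p(2) by (intro power_mono) (auto simp: N_def)
    also have "\<dots> \<le> ratio V E {fst p, snd p} ^ q p"
      using \<open>q p \<le> Q\<close> by (intro power_decreasing ratio_le_1 V) auto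
    also have "\<dots> \<le> max (ratio V E lower) (ratio V E upper)" by (rule q[OF p(1) V])
    finally show ?thesis .
  next
    case False
    let ?h = "real (card (maps V E incl {}))"
    have h: "?h > 0" using ne finite_maps[OF V, of E incl "{}"] by (simp add: card_gt_0_iff)
    have "maps V E incl {} \<subseteq> (\<Union>p\<in>PP. maps V E incl {fst p, snd p})"
    proof
      fix f assume f: "f \<in> maps V E incl {}"
      then have edge: "(f S, f T) \<in> E" if "(S, T) \<in> incl" for S T
        using that by (auto simp: maps_def compat_def)
      have fl: "f S \<in> X" if "S \<in> lower" for S using lower_has_edge[OF that] edge E by blast
      have fu: "f T \<in> Y" if "T \<in> upper" for T using upper_has_edge[OF that] edge E by blast
      obtain x y where xy: "x \<in> verts" "y \<in> verts" "x \<noteq> y" "f x = f y"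
        using ninj f unfolding inj_on_def by blast
      then have "(x, y) \<in> PP" using fl[of x] fl[of y] fu[of x] fu[of y] E(2)
        unfolding PP_def verts_def mem_Collect_eq prod.case by (metis Un_iff disjoint_iff)
      moreover have "f \<in> maps V E incl {x, y}"
        using f xy(4) unfolding maps_def compat_def by simp
      ultimately show "f \<in> (\<Union>p\<in>PP. maps V E incl {fst p, snd p})" by force
    qed
    then have "card (maps V E incl {}) \<le> card (\<Union>p\<in>PP. maps V E incl {fst p, snd p})"
      using V finPP by (intro card_mono) auto
    also have "\<dots> \<le> (\<Sum>p\<in>PP. card (maps V E incl {fst p, snd p}))"
      using finPP by (rule card_UN_le)
    finally have "?h \<le> real (\<Sum>p\<in>PP. card (maps V E incl {fst p, snd p}))"
      by (simp only: of_nat_le_iff)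
    also have "\<dots> = (\<Sum>p\<in>PP. real (card (maps V E incl {fst p, snd p})))" by simp
    also have "\<dots> \<le> (\<Sum>p\<in>PP. ?h / N)"
    proof (rule sum_mono)
      fix p assume "p \<in> PP"
      then have "ratio V E {fst p, snd p} \<le> 1 / N" using False by auto
      then show "real (card (maps V E incl {fst p, snd p})) \<le> ?h / N"
        using h by (simp add: ratio_def field_simps N_def)
    qed
    also have "\<dots> = ?h * (card PP / N)" by simp
    also have "\<dots> < ?h * 1" using h by (intro mult_strict_left_mono) (auto simp: N_def)
    finally show ?thesis by simp
  qed
  moreover have "(1 / N) ^ Q > 0" by (simp add: N_def add_pos_nonneg add_nonneg_pos)
  ultimately show ?thesis
    by (intro exI[of _ "(1 / N) ^ Q"] conjI allI impI; (elim conjE)?) (assumption, rule bound)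
qed

section \<open>Counting homomorphisms against the maximum degree\<close>

lemma card_layers: "card lower = k choose l" "card upper = k choose l"
proof -
  show "card lower = k choose l" using n_subsets[of "{1..k}" l] by (simp add: lower_def)
  have "card upper = k choose (k - l)" using n_subsets[of "{1..k}" "k - l"] by (simp add: upper_def)
  then show "card upper = k choose l" using binomial_symmetric[of l k] l_less by simp
qed

lemma card_verts: "card verts = 2 * (k choose l)"
  unfolding verts_def using layers_disjoint by (simp add: card_Un_disjoint card_layers)

lemma card_incl: "card incl = (k choose l) * (k - l choose l)"
proof -
  have "incl = prod.swap ` (SIGMA T : upper. {S. S \<subseteq> T \<and> card S = l})"
    by (auto simp: incl_def lower_def upper_def image_iff)
  then have "card incl = card (SIGMA T : upper. {S. S \<subseteq> T \<and> card S = l})"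
    by (simp add: card_image)
  also have "\<dots> = (\<Sum>T\<in>upper. card {S. S \<subseteq> T \<and> card S = l})"
    by (intro card_SigmaI) (auto simp: upper_def finite_subset)
  also have "\<dots> = (\<Sum>T\<in>upper. (k - l choose l))"
  proof (rule sum.cong[OF refl])
    fix T assume "T \<in> upper"
    then have "finite T" "card T = k - l" by (auto simp: upper_def finite_subset)
    then show "card {S. S \<subseteq> T \<and> card S = l} = (k - l choose l)" by (simp add: n_subsets)
  qed
  finally show ?thesis by (simp add: card_layers)
qed

text \<open>Such a map is determined by its common value on the lower layer and by an out-neighbour
  of that value for each upper vertex.\<close>

lemma card_maps_lower:
  assumes V: "finite V" and E: "E \<subseteq> V \<times> V" and D: "\<And>v. card (E `` {v}) \<le> D"
  shows "card (maps V E incl lower) \<le> card V * D ^ (k choose l)"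
proof -
  have "{1..l} \<in> lower" using l_less by (auto simp: lower_def)
  then obtain S0 where S0: "S0 \<in> lower" by blast
  let ?T = "SIGMA v : V. upper \<rightarrow>\<^sub>E E `` {v}"
  have finE: "finite (E `` {v})" for v
    using E V by (intro finite_subset[of "E `` {v}" V]) auto
  have const: "f S = f S0" if "f \<in> maps V E incl lower" "S \<in> lower" for f S
    using that S0 unfolding maps_def compat_def by blast
  have "inj_on (\<lambda>f. (f S0, restrict f upper)) (maps V E incl lower)"
  proof (rule inj_onI)
    fix f g assume f: "f \<in> maps V E incl lower" and g: "g \<in> maps V E incl lower"
      and eq: "(f S0, restrict f upper) = (g S0, restrict g upper)"
    show "f = g"
    proof
      fix v
      consider "v \<in> lower" | "v \<in> upper" | "v \<notin> verts" by (auto simp: verts_def)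
      then show "f v = g v"
      proof cases
        case 1 then show ?thesis using const[OF f] const[OF g] eq by simp
      next
        case 2
        moreover have "restrict f upper v = restrict g upper v" using eq by simp
        ultimately show ?thesis by simp
      next
        case 3 then show ?thesis using f g by (auto simp: maps_def PiE_def extensional_def)
      qed
    qed
  qed
  moreover have "(\<lambda>f. (f S0, restrict f upper)) ` maps V E incl lower \<subseteq> ?T"
  proof (rule image_subsetI)
    fix f assume f: "f \<in> maps V E incl lower"
    have "f S0 \<in> V" using f S0 by (auto simp: maps_def verts_def)
    moreover have "(f S0, f T) \<in> E" if T: "T \<in> upper" for T
    proof -
      obtain S where S: "(S, T) \<in> incl" using upper_has_edge[OF T] by blast
      then have "f S = f S0" using const[OF f, of S] by (auto simp: incl_def)
      moreover have "(f S, f T) \<in> E" using f S unfolding maps_def compat_def by blast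
      ultimately show ?thesis by simp
    qed
    ultimately show "(f S0, restrict f upper) \<in> ?T" by auto
  qed
  ultimately have "card (maps V E incl lower) \<le> card ?T"
    using V finE by (intro card_inj_on_le) (auto simp: finite_PiE)
  also have "\<dots> = (\<Sum>v\<in>V. card (E `` {v}) ^ (k choose l))"
    using V finE by (simp add: card_SigmaI finite_PiE card_PiE card_layers)
  also have "\<dots> \<le> (\<Sum>v\<in>V. D ^ (k choose l))"
    using D by (intro sum_mono power_mono) auto
  finally show ?thesis by simp
qed

text \<open>Sidorenko bounds the number of homomorphisms from below. From above, a fraction
  \<open>\<delta>\<close> of them is constant on one layer, which \<open>card_maps_lower\<close>
  counts, after reversing the host in the case of the upper layer.\<close>

lemma density_bound:
  "\<exists>c>0. \<forall>V (E :: (nat \<times> nat) set) X Y D. finite V \<and> V \<noteq> {} \<and> E \<subseteq> V \<times> V \<and> E \<subseteq> X \<times> Y \<and> X \<inter> Y = {} \<and>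
     (\<forall>v. card (E `` {v}) \<le> D) \<and> (\<forall>v. card (E\<inverse> `` {v}) \<le> D) \<and>
     (\<forall>f\<in>maps V E incl {}. \<not> inj_on f verts) \<longrightarrow>
     (card E / (card V)\<^sup>2) ^ ((k choose l) * (k - l choose l)) \<le>
       c * (card V * real D ^ (k choose l)) / real (card V) ^ (2 * (k choose l))"
proof -
  obtain \<delta> where \<delta>: "\<delta> > 0"
    "\<And>V (E :: (nat \<times> nat) set) X Y. finite V \<Longrightarrow> E \<subseteq> X \<times> Y \<Longrightarrow> X \<inter> Y = {} \<Longrightarrow>
     maps V E incl {} \<noteq> {} \<Longrightarrow> (\<forall>f\<in>maps V E incl {}. \<not> inj_on f verts) \<Longrightarrow>
     \<delta> \<le> max (ratio V E lower) (ratio V E upper)"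
    using concentrated_or_injective by meson
  have bound: "(card E / (card V)\<^sup>2) ^ ((k choose l) * (k - l choose l)) \<le>
       1 / \<delta> * (card V * real D ^ (k choose l)) / real (card V) ^ (2 * (k choose l))"
    if V: "finite V" "V \<noteq> {}" and E: "E \<subseteq> V \<times> V" and XY: "E \<subseteq> X \<times> Y" "X \<inter> Y = {}"
      and D: "\<And>v. card (E `` {v}) \<le> D" "\<And>v. card (E\<inverse> `` {v}) \<le> D"
      and ninj: "\<forall>f\<in>maps V E incl {}. \<not> inj_on f verts"
    for V X Y D and E :: "(nat \<times> nat) set"
  proof -
    let ?h = "real (card (maps V E incl {}))"
    have "(card E / (card V)\<^sup>2) ^ ((k choose l) * (k - l choose l)) \<le> ?h / real (card V) ^ (2 * (k choose l))"
      using sidorenko[OF V E] by (simp add: card_incl card_verts)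
    also have "\<dots> \<le> 1 / \<delta> * (card V * real D ^ (k choose l)) / real (card V) ^ (2 * (k choose l))"
    proof (intro divide_right_mono)
      show "?h \<le> 1 / \<delta> * (card V * real D ^ (k choose l))"
      proof (cases "maps V E incl {} = {}")
        case True
        then show ?thesis using \<delta>(1) by simp
      next
        case False
        then have h: "?h > 0" using finite_maps[OF V(1), of E incl "{}"] by (simp add: card_gt_0_iff)
        have "card (maps V E incl lower) \<le> card V * D ^ (k choose l)"
          by (rule card_maps_lower[OF V(1) E D(1)])
        then have low: "ratio V E lower \<le> card V * real D ^ (k choose l) / ?h"
          unfolding ratio_def by (intro divide_right_mono) (auto simp flip: of_nat_power of_nat_mult)
        have "card (maps V E incl upper) = card (maps V (E\<inverse>) incl lower)"
          using card_maps_compl[of upper V E] by (simp add: compl_image_upper verts_def)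
        also have "\<dots> \<le> card V * D ^ (k choose l)"
          using E by (intro card_maps_lower V D) auto
        finally have "ratio V E upper \<le> card V * real D ^ (k choose l) / ?h"
          unfolding ratio_def by (intro divide_right_mono) (auto simp flip: of_nat_power of_nat_mult)
        with low \<delta>(2)[OF V(1) XY False ninj] have "\<delta> \<le> card V * real D ^ (k choose l) / ?h" by simp
        then show ?thesis using \<delta>(1) h by (simp add: field_simps)
      qed
    qed simp
    finally show ?thesis .
  qed
  moreover have "1 / \<delta> > 0" using \<delta>(1) by simp
  ultimately show ?thesis
    apply (intro exI[of _ "1 / \<delta>"] conjI allI impI)
     apply assumption
    subgoal for V E X Y D
      by (elim conjE, rule bound[of V E X Y]; (assumption | erule spec))
    done
qed

section \<open>The extremal number\<close>

lemma maps_mono_host: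
  assumes "f \<in> maps V' E' J Z" "V' \<subseteq> V" "E' \<subseteq> E"
  shows "f \<in> maps V E J Z"
proof -
  have "f \<in> verts \<rightarrow>\<^sub>E V" using assms by (auto simp: maps_def)
  then show ?thesis using assms(1,3) unfolding maps_def compat_def by blast
qed

text \<open>Strong induction on \<open>card V\<close>. In a failing host all smaller vertex sets are
  sparse, so it can be regularized and cut into a bipartite host with bounded degrees and at least
  an eighth of the arcs. There \<open>density_bound\<close> and \<open>density_arith\<close>
  contradict the choice of \<open>R\<close>.\<close>

lemma digraph_bound:
  fixes m d :: nat and \<epsilon> \<beta> :: real
  defines "m \<equiv> k choose l" and "d \<equiv> k - l choose l"
  defines "\<epsilon> \<equiv> (real m - real d) / (real d * real m * (real d - 1))"
  defines "\<beta> \<equiv> 2 - 1 / real d - \<epsilon>"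
  assumes d: "2 \<le> d" and dm: "d < m"
  shows "\<exists>R>0. \<forall>V (E :: (nat \<times> nat) set). finite V \<and> E \<subseteq> V \<times> V \<and> (\<forall>v. (v, v) \<notin> E) \<and>
     (\<forall>f\<in>maps V E incl {}. \<not> inj_on f verts) \<longrightarrow> card E \<le> R * card V powr \<beta>"
proof -
  have d': "real d \<ge> 2" using d by simp
  have m': "real m > real d" using dm by simp
  have "\<epsilon> > 0" using d' m' by (simp add: \<epsilon>_def)
  \<comment> \<open>The factor \<open>(m - d) / m\<close> is below 1. The resulting bound
    \<open>\<beta> > 1\<close> is what allows a suitable \<open>K\<close>.\<close>
  have "\<epsilon> < 1 / (real d * (real d - 1))"
    using d' m' by (simp add: \<epsilon>_def field_simps)
  also have "\<dots> \<le> (real d - 1) / real d"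
  proof -
    have "1 * 1 \<le> (real d - 1) * (real d - 1)" using d' by (intro mult_mono) auto
    then show ?thesis using d' by (simp add: divide_simps)
  qed
  also have "\<dots> = 1 - 1 / real d" using d' by (simp add: field_simps)
  finally have \<beta>1: "1 < \<beta>" by (simp add: \<beta>_def)
  have "0 \<le> 1 / real d" by simp
  then have \<beta>2: "\<beta> \<le> 2" using \<open>\<epsilon> > 0\<close> unfolding \<beta>_def by linarith
  \<comment> \<open>\<open>\<epsilon>\<close> is defined so that this balance of exponents
    holds.\<close>
  have \<beta>_eq: "\<beta> * (real m * real d - real m) = 2 * real m * real d - 3 * real m + 1"
  proof -
    have "\<epsilon> * (real m * real d - real m) = real m / real d - 1"
    proof -
      have "real m * real d - real m = real m * (real d - 1)" by (simp add: algebra_simps)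
      then have "\<epsilon> * (real m * real d - real m) = (real m - real d) / real d"
        using d' m' by (simp add: \<epsilon>_def)
      then show ?thesis using d' by (simp add: diff_divide_distrib)
    qed
    moreover have "1 / real d * (real m * real d - real m) = real m - real m / real d"
      using d' by (simp add: field_simps)
    ultimately show ?thesis by (simp add: \<beta>_def left_diff_distrib)
  qed
  obtain c where c: "c > 0" and bound:
    "\<And>V (E :: (nat \<times> nat) set) X Y D. finite V \<Longrightarrow> V \<noteq> {} \<Longrightarrow> E \<subseteq> V \<times> V \<Longrightarrow> E \<subseteq> X \<times> Y \<Longrightarrow> X \<inter> Y = {} \<Longrightarrow>
     (\<forall>v. card (E `` {v}) \<le> D) \<Longrightarrow> (\<forall>v. card (E\<inverse> `` {v}) \<le> D) \<Longrightarrow>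
     (\<forall>f\<in>maps V E incl {}. \<not> inj_on f verts) \<Longrightarrow>
     (card E / (card V)\<^sup>2) ^ (m * d) \<le> c * (card V * real D ^ m) / real (card V) ^ (2 * m)"
    using density_bound unfolding m_def d_def by meson
  define K where "K = max 3 (nat \<lceil>48 powr (1 / (\<beta> - 1))\<rceil>)"
  have K3: "3 \<le> K" by (simp add: K_def)
  have "48 powr (1 / (\<beta> - 1)) \<le> K" unfolding K_def by linarith
  then have "(48 powr (1 / (\<beta> - 1))) powr (\<beta> - 1) \<le> real K powr (\<beta> - 1)"
    using \<beta>1 by (intro powr_mono2) auto
  then have K\<beta>: "48 \<le> real K powr (\<beta> - 1)" using \<beta>1 by (simp add: powr_powr)
  \<comment> \<open>\<open>K ^ 2\<close> covers hosts with fewer than \<open>K\<close> vertices by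
    counting all pairs, the last term is what \<open>density_arith\<close> is to contradict, and 1
    meets its hypothesis on \<open>R\<close>.\<close>
  define R where "R = max (max 1 (real K ^ 2)) (c * 8 ^ (m * d) * (2 * real K) ^ m)"
  have R: "1 \<le> R" "real K ^ 2 \<le> R" "c * 8 ^ (m * d) * (2 * real K) ^ m \<le> R" by (auto simp: R_def)
  have main: "card E \<le> R * card V powr \<beta>"
    if "finite V" "E \<subseteq> V \<times> V" "\<And>v. (v, v) \<notin> E" "\<And>f. f \<in> maps V E incl {} \<Longrightarrow> \<not> inj_on f verts"
    for V and E :: "(nat \<times> nat) set"
    using that
  proof (induction "card V" arbitrary: V E rule: less_induct)
    case less
    define n where "n = card V"
    show ?case
    proof (cases "K \<le> n")
      case False
      show ?thesis
      proof (cases "V = {}")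
        case True
        then show ?thesis using less.prems(2) by simp
      next
        case False
        then have n1: "1 \<le> n" using less.prems(1) by (simp add: n_def Suc_le_eq card_gt_0_iff)
        have "card E \<le> card (V \<times> V)" using less.prems by (intro card_mono) auto
        then have "card E \<le> n * n" by (simp add: n_def card_cartesian_product)
        also have "\<dots> \<le> K * K" using \<open>\<not> K \<le> n\<close> by (intro mult_mono) auto
        finally have "real (card E) \<le> real K ^ 2" by (simp add: power2_eq_square flip: of_nat_mult)
        also have "\<dots> \<le> R * 1" using R by simp
        also have "\<dots> \<le> R * n powr \<beta>"
          using R n1 \<beta>1 by (intro mult_left_mono ge_one_powr_ge_zero) auto
        finally show ?thesis by (simp add: n_def)
      qed
    next
      case True
      show ?thesis
      proof (rule ccontr)
        assume "\<not> ?thesis"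
        then have big: "R * card V powr \<beta> < card E" by simp
        have sparse: "card (E \<inter> W \<times> W) \<le> R * card W powr \<beta>" if "W \<subseteq> V" "card W < card V" for W
        proof (rule less.hyps[OF that(2)])
          show "finite W" using that(1) less.prems(1) finite_subset by blast
          show "(v, v) \<notin> E \<inter> W \<times> W" for v using less.prems(3) by blast
          show "\<not> inj_on f verts" if "f \<in> maps W (E \<inter> W \<times> W) incl {}" for f
            using less.prems(4) maps_mono_host[OF that \<open>W \<subseteq> V\<close>] by blast
        qed auto
        obtain E1 where E1: "E1 \<subseteq> E" "card E \<le> 2 * card E1"
          "\<And>v. card (E1 `` {v}) \<le> 2 * K * card E / card V"
          "\<And>v. card (E1\<inverse> `` {v}) \<le> 2 * K * card E / card V"
          using ex_degree_bounded_subgraph[OF less.prems(1,2) K3 _ \<beta>1 \<beta>2 K\<beta> _ sparse big] True R(1)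
          unfolding n_def by auto
        have E1': "E1 \<subseteq> V \<times> V" "\<And>v. (v, v) \<notin> E1" using E1(1) less.prems by auto
        obtain X where X: "X \<subseteq> V" "card E1 \<le> 4 * card (E1 \<inter> X \<times> (V - X))"
          using ex_directed_cut[OF less.prems(1) E1'] by blast
        define E2 where "E2 = E1 \<inter> X \<times> (V - X)"
        \<comment> \<open>Degrees are integers, so rounding down loses nothing.\<close>
        define D where "D = nat \<lfloor>2 * K * card E / card V\<rfloor>"
        have n1: "1 \<le> n" using True K3 by simp
        have V0: "V \<noteq> {}" using n1 by (auto simp: n_def)
        have fin1: "finite (E1 `` {v})" "finite (E1\<inverse> `` {v})" for v
          using E1' less.prems(1) by (auto intro!: finite_subset[of _ V])
        have deg2: "card (E2 `` {v}) \<le> D" "card (E2\<inverse> `` {v}) \<le> D" for v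
        proof -
          have "card (E2 `` {v}) \<le> card (E1 `` {v})" "card (E2\<inverse> `` {v}) \<le> card (E1\<inverse> `` {v})"
            using fin1 by (auto intro!: card_mono simp: E2_def)
          then show "card (E2 `` {v}) \<le> D" "card (E2\<inverse> `` {v}) \<le> D"
            using E1(3,4)[of v] unfolding D_def by linarith+
        qed
        have D: "real D \<le> 2 * K * real (card E) / n"
          unfolding D_def n_def by (simp add: of_nat_nat)
        \<comment> \<open>Regularization costs a factor 2 and the directed cut a factor 4.\<close>
        have E8: "card E \<le> 8 * card E2" using E1(2) X(2) by (simp add: E2_def)
        have "(card E / (8 * (real n)\<^sup>2)) ^ (m * d) \<le> (card E2 / (real n)\<^sup>2) ^ (m * d)"
          using E8 n1 by (intro power_mono) (auto simp: divide_simps)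
        also have "\<dots> \<le> c * (n * real D ^ m) / real n ^ (2 * m)"
        proof -
          have "\<forall>f\<in>maps V E2 incl {}. \<not> inj_on f verts"
            using less.prems(4) maps_mono_host[of _ V E2 incl "{}" V E] E1(1) by (auto simp: E2_def)
          moreover have "E2 \<subseteq> X \<times> (V - X)" "E2 \<subseteq> V \<times> V" using E1' by (auto simp: E2_def)
          ultimately show ?thesis
            using bound[of V E2 X "V - X" D] less.prems(1) V0 deg2 by (simp add: n_def)
        qed
        also have "\<dots> \<le> c * (n * (2 * K * real (card E) / n) ^ m) / real n ^ (2 * m)"
          using D c by (intro divide_right_mono mult_left_mono power_mono) auto
        finally have "R < c * 8 ^ (m * d) * (2 * real K) ^ m"
          using big d dm n1 R(1) K3 \<beta>_eq
          by (intro density_arith[where n = n and e = "card E" and \<beta> = \<beta>]) (auto simp: n_def)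
        then show False using R(3) by simp
      qed
    qed
  qed
  have "0 < R" using R(1) by simp
  then show ?thesis
    apply (intro exI[of _ R] conjI allI impI)
     apply assumption
    subgoal for V E
      by (elim conjE, rule main[of V E]; (assumption | erule spec | erule bspec))
    done
qed

text \<open>These bounds make the denominator and the numerator of \<open>\<epsilon>\<close>
  positive. The second follows from Pascal's rule, because \<open>k - l \<le> k - 1\<close>.\<close>

lemma degree_less: "2 \<le> (k - l choose l)" "(k - l choose l) < (k choose l)"
proof -
  have "l + 1 choose l \<le> (k - l choose l)" using l_less by (intro binomial_right_mono) simp
  then show "2 \<le> (k - l choose l)" using l_pos by simp
  obtain k' l' where kl: "k = Suc k'" "l = Suc l'"
    using l_pos l_less by (metis Suc_le_D gr_implies_not0 not0_implies_Suc One_nat_def)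
  have "(k - l choose l) \<le> (k' choose l)" using kl by (intro binomial_right_mono) simp
  moreover have "0 < (k' choose l')" using l_less kl by simp
  moreover have "(k choose l) = (k' choose l') + (k' choose l)" using kl by simp
  ultimately show "(k - l choose l) < (k choose l)" by linarith
qed

lemma H_graph_eq: "vertices (H_graph l k) = verts" "edges (H_graph l k) = {{S, T} | S T. (S, T) \<in> incl}"
proof -
  have nsets_eq: "[{1..k}]\<^bsup>r\<^esup> = {S. S \<subseteq> {1..k} \<and> card S = r}" for r
    unfolding nsets_def using finite_subset[of _ "{1..k}"] by blast
  then show "vertices (H_graph l k) = verts"
    by (simp add: H_graph_def verts_def lower_def upper_def)
  show "edges (H_graph l k) = {{S, T} | S T. (S, T) \<in> incl}"
  proof -
    \<comment> \<open>The layers are disjoint, so proper inclusion and inclusion agree here.\<close>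
    have "S \<noteq> T" if "(S, T) \<in> incl" for S T using that layers_disjoint by (auto simp: incl_def)
    then have "(S, T) \<in> incl \<longleftrightarrow> S \<in> [{1..k}]\<^bsup>l\<^esup> \<and> T \<in> [{1..k}]\<^bsup>(k - l)\<^esup> \<and> S \<subset> T" for S T
      unfolding nsets_eq incl_def lower_def upper_def by blast
    then show ?thesis by (simp add: H_graph_def)
  qed
qed

lemma contains_copy_if_injective:
  fixes G :: "nat ugraph"
  assumes G: "simple_graph G"
    and f: "f \<in> maps (vertices G) {(u, v). {u, v} \<in> edges G} incl {}" and inj: "inj_on f verts"
  shows "contains_copy G (H_graph l k)"
proof -
  let ?F = "UGraph (f ` verts) {{f S, f T} | S T. (S, T) \<in> incl}"
  let ?g = "inv_into verts f"
  have incl_verts: "S \<in> verts" "T \<in> verts" if "(S, T) \<in> incl" for S T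
    using that by (auto simp: incl_def verts_def)
  have fG: "f ` verts \<subseteq> vertices G" using f by (auto simp: maps_def)
  have fE: "{f S, f T} \<in> edges G" if "(S, T) \<in> incl" for S T
    using f that by (auto simp: maps_def compat_def)
  have "subgraph ?F G"
  proof -
    have "{f S, f T} \<in> [f ` verts]\<^bsup>2\<^esup>" if "(S, T) \<in> incl" for S T
    proof -
      have "f S \<noteq> f T"
        using inj incl_verts[OF that] that layers_disjoint
        by (auto simp: inj_on_eq_iff incl_def)
      then show ?thesis using incl_verts[OF that] by simp
    qed
    then have "simple_graph ?F" by (auto simp: simple_graph_def)
    then show ?thesis using fG fE by (auto simp: subgraph_def)
  qed
  moreover have "isomorphic ?F (H_graph l k)"
  proof -
    have "bij_betw ?g (vertices ?F) (vertices (H_graph l k))"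
      using inj bij_betw_inv_into[of f verts "f ` verts"] by (simp add: H_graph_eq bij_betw_def)
    moreover have "{u, v} \<in> edges ?F \<longleftrightarrow> {?g u, ?g v} \<in> edges (H_graph l k)"
      if uv: "u \<in> vertices ?F" "v \<in> vertices ?F" for u v
    proof -
      obtain a b where ab: "a \<in> verts" "u = f a" "b \<in> verts" "v = f b" using uv by auto
      have "{f a, f b} = {f S, f T} \<longleftrightarrow> {a, b} = {S, T}" if "(S, T) \<in> incl" for S T
        using inj ab incl_verts[OF that] by (auto simp: doubleton_eq_iff inj_on_eq_iff)
      then have "{f a, f b} \<in> {{f S, f T} | S T. (S, T) \<in> incl} \<longleftrightarrow> {a, b} \<in> {{S, T} | S T. (S, T) \<in> incl}"
        unfolding mem_Collect_eq by (intro ex_cong1) metis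
      then show ?thesis using ab inj by (simp add: H_graph_eq)
    qed
    ultimately show ?thesis unfolding isomorphic_def by blast
  qed
  ultimately show ?thesis unfolding contains_copy_def by blast
qed

end

theorem theorem1p7:
  fixes l k d :: nat
  assumes "1 \<le> l" and "2 * l < k"
    and "\<forall>v \<in> vertices (H_graph l k). degree (H_graph l k) v = d"
  shows "\<exists>\<epsilon>::real. \<epsilon> > 0 \<and> (\<exists>C::real. C > 0 \<and>
    (\<forall>n::nat. n \<ge> 1 \<longrightarrow>
      real (ex n (H_graph l k)) \<le> C * real n powr (2 - 1 / real d - \<epsilon>)))"
proof -
  interpret subset_layers k l using assms by unfold_locales
  have v: "{1..l} \<in> vertices (H_graph l k)"
    using assms by (auto simp: H_graph_eq verts_def lower_def)
  then have d: "d = (k - l choose l)" using assms(3) H_graph_regular[OF assms(2) v] by simp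
  let ?m = "k choose l"
  define \<epsilon> where "\<epsilon> = (real ?m - real d) / (real d * real ?m * (real d - 1))"
  have dm: "2 \<le> d" "d < ?m" using degree_less by (simp_all add: d)
  have "2 \<le> real d" "real d < real ?m" using dm by simp_all
  then have "\<epsilon> > 0" unfolding \<epsilon>_def by (intro divide_pos_pos mult_pos_pos) linarith+
  obtain C where C: "C > 0" and bound: "\<And>V (E :: (nat \<times> nat) set). finite V \<Longrightarrow> E \<subseteq> V \<times> V \<Longrightarrow>
      (\<forall>v. (v, v) \<notin> E) \<Longrightarrow> (\<forall>f\<in>maps V E incl {}. \<not> inj_on f verts) \<Longrightarrow>
      card E \<le> C * card V powr (2 - 1 / real d - \<epsilon>)"
    using digraph_bound degree_less unfolding \<epsilon>_def d by meson
  have "real (ex n (H_graph l k)) \<le> C * real n powr (2 - 1 / real d - \<epsilon>)" for n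
  proof -
    obtain T where "({1..l}, T) \<in> incl"
      using lower_has_edge[of "{1..l}"] assms by (auto simp: lower_def)
    \<comment> \<open>An edge in the pattern guarantees that the maximum defining \<open>ex\<close>
      is attained.\<close>
    then have "edges (H_graph l k) \<noteq> {}" by (auto simp: H_graph_eq)
    then obtain G :: "nat ugraph" where G: "simple_graph G" "card (vertices G) = n"
      "\<not> contains_copy G (H_graph l k)" "card (edges G) = ex n (H_graph l k)"
      using ex_attained[OF simple_graph_H_graph, of l k n] by blast
    \<comment> \<open>The symmetric digraph of \<open>G\<close>: it has no loops and at least as
      many arcs as \<open>G\<close> has edges.\<close>
    let ?E = "{(u, v). {u, v} \<in> edges G}"
    have V: "finite (vertices G)" and sub: "edges G \<subseteq> [vertices G]\<^bsup>2\<^esup>"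
      using G(1) by (auto simp: simple_graph_def)
    have E: "?E \<subseteq> vertices G \<times> vertices G" and irr: "\<forall>v. (v, v) \<notin> ?E"
      using sub by (auto simp: nsets_def)
    have "edges G \<subseteq> (\<lambda>(u, v). {u, v}) ` ?E"
    proof
      fix e assume e: "e \<in> edges G"
      then obtain u v where "e = {u, v}" using sub by (auto simp: nsets_def card_2_iff)
      then show "e \<in> (\<lambda>(u, v). {u, v}) ` ?E" using e by auto
    qed
    moreover have "finite ?E" using E V finite_subset by blast
    ultimately have "card (edges G) \<le> card ?E"
      by (meson card_image_le card_mono finite_imageI le_trans)
    also have "card ?E \<le> C * card (vertices G) powr (2 - 1 / real d - \<epsilon>)"
      using contains_copy_if_injective[OF G(1)] G(3) by (intro bound V E irr) blast
    finally show ?thesis using G(2,4) by simp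
  qed
  then show ?thesis using C \<open>\<epsilon> > 0\<close> by blast
qed

end
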